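(* Fix an integer $n>1$ and let $f_n:[1,2n+1]\to[1,2n+1]$ be the continuous function with $f_n(1)=n+1$, $f_n(2)=2n+1$, $f_n(n+1)=n+2$, $f_n(n+2)=n$, $f_n(2n+1)=1$, which is affine on each of the intervals $[1,2]$, $[2,n+1]$, $[n+1,n+2]$, $[n+2,2n+1]$. Then: (a) for every positive integer $k$, the equation $f_n^k(x)=x$ has exactly $c_{k,n}$ distinct solutions in $[1,2n+1]$; (b) for every positive integer $m$, $f_n$ has exactly $\Phi_n(m)/m$ distinct periodic orbits of minimal period $m$; (c) $\lim_{m\to\infty}\frac{1}{m}\log\big(\Phi_n(m)/m\big)=\log\lambda_n$, where $\lambda_n$ is the unique positive zero (which is also the zero of largest absolute value) of the polynomial $x^{2n+1}-2x^{2n-1}-1$.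
   Context: Fix $n>1$. Let $Q_n=\{(1,n+1)\}\cup\{(m,2n+2-m):2\le m\le n\}\cup\{(m,2n+1-m):n+1\le m\le 2n\}$. For integers $1\le i,j\le 2n$ and $k\ge1$ define $b_{k,i,j,n}$ recursively by $b_{1,i,j,n}=1$ if $(i,j)\in Q_n$ and $0$ otherwise, and $b_{k+1,i,j,n}=b_{k,i,2n+1-j,n}+b_{k,i,n+1,n}$ if $1\le j\le n-1$; $b_{k+1,i,n,n}=b_{k,i,n,n}+b_{k,i,n+1,n}$; $b_{k+1,i,n+1,n}=b_{k,i,1,n}$; $b_{k+1,i,j,n}=b_{k,i,2n+2-j,n}$ if $n+2\le j\le 2n$. Define $c_{k,n}=\sum_{i=1}^{2n}b_{k,i,i,n}+b_{k,n+1,n,n}+\sum_{i=n+2}^{2n}b_{k,i,n+1,n}$. For an integer-valued function $\phi$ on the positive integers, $\Phi(m,\phi)=\sum_{d\mid m}\mu(m/d)\phi(d)$ ($\mu$ the Möbius function); equivalently $\Phi(1,\phi)=\phi(1)$ and for $m=p_1^{k_1}\cdots p_r^{k_r}$ (distinct primes) $\Phi(m,\phi)=\phi(m)-\sum_i\phi(m/p_i)+\sum_{i_1<i_2}\phi(m/(p_{i_1}p_{i_2}))-\cdots+(-1)^r\phi(m/(p_1\cdots p_r))$. Set $\phi_n(k)=c_{k,n}$ and $\Phi_n(m)=\Phi(m,\phi_n)$. Minimal period $m$ of a point $x$: $f^m(x)=x$ and the orbit of $x$ has exactly $m$ elements. *)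

theory Defs
  imports "HOL-Analysis.Analysis" "HOL-Computational_Algebra.Computational_Algebra"
begin

definition affine_interp :: "real \<Rightarrow> real \<Rightarrow> real \<Rightarrow> real \<Rightarrow> real \<Rightarrow> real" where
  "affine_interp a b fa fb x = fa + (x - a) / (b - a) * (fb - fa)"

(* f_n on [1,2n+1]; values outside [1,2n+1] are irrelevant (identity there) *)
definition fmap :: "nat \<Rightarrow> real \<Rightarrow> real" where
  "fmap n x =
    (if 1 \<le> x \<and> x \<le> 2 then affine_interp 1 2 (real n + 1) (2 * real n + 1) x
     else if 2 \<le> x \<and> x \<le> real n + 1 then affine_interp 2 (real n + 1) (2 * real n + 1) (real n + 2) x
     else if real n + 1 \<le> x \<and> x \<le> real n + 2 then affine_interp (real n + 1) (real n + 2) (real n + 2) (real n) x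
     else if real n + 2 \<le> x \<and> x \<le> 2 * real n + 1 then affine_interp (real n + 2) (2 * real n + 1) (real n) 1 x
     else x)"

definition inQ :: "nat \<Rightarrow> nat \<Rightarrow> nat \<Rightarrow> bool" where
  "inQ n i j \<longleftrightarrow> (i = 1 \<and> j = n + 1) \<or> (2 \<le> i \<and> i \<le> n \<and> j = 2 * n + 2 - i)
                 \<or> (n + 1 \<le> i \<and> i \<le> 2 * n \<and> j = 2 * n + 1 - i)"

(* bcoef k i j n = b_{k,i,j,n}, for k \<ge> 1 and 1 \<le> i,j \<le> 2n *)
fun bcoef :: "nat \<Rightarrow> nat \<Rightarrow> nat \<Rightarrow> nat \<Rightarrow> nat" where
  "bcoef 0 i j n = 0"
| "bcoef (Suc 0) i j n = (if inQ n i j then 1 else 0)"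
| "bcoef (Suc (Suc k)) i j n =
     (if 1 \<le> j \<and> j \<le> n - 1 then bcoef (Suc k) i (2 * n + 1 - j) n + bcoef (Suc k) i (n + 1) n
      else if j = n then bcoef (Suc k) i n n + bcoef (Suc k) i (n + 1) n
      else if j = n + 1 then bcoef (Suc k) i 1 n
      else if n + 2 \<le> j \<and> j \<le> 2 * n then bcoef (Suc k) i (2 * n + 2 - j) n
      else 0)"

definition ccoef :: "nat \<Rightarrow> nat \<Rightarrow> nat" where
  "ccoef k n = (\<Sum>i = 1..2 * n. bcoef k i i n) + bcoef k (n + 1) n n
               + (\<Sum>i = n + 2..2 * n. bcoef k i (n + 1) n)"

definition moebius :: "nat \<Rightarrow> int" where
  "moebius m = (if m = 0 then 0 else if squarefree m then (-1) ^ card (prime_factors m) else 0)"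

definition PhiM :: "nat \<Rightarrow> (nat \<Rightarrow> int) \<Rightarrow> int" where
  "PhiM m \<phi> = (\<Sum>d \<in> {d. d dvd m}. moebius (m div d) * \<phi> d)"

definition Phi_n :: "nat \<Rightarrow> nat \<Rightarrow> int" where
  "Phi_n n m = PhiM m (\<lambda>k. int (ccoef k n))"

definition orbit :: "(real \<Rightarrow> real) \<Rightarrow> real \<Rightarrow> real set" where
  "orbit f x = {(f ^^ j) x | j. True}"

end

theory Submission
  imports Defs
begin

text \<open>The intervals \<open>J\<^sub>i = [i, i + 1]\<close>, \<open>1 \<le> i \<le> 2n\<close>, form a Markov partition for \<open>f\<^sub>n\<close>, and \<open>c\<^sub>k\<^sub>,\<^sub>n\<close> is the
  trace of the \<open>k\<close>-th power of its transition matrix, that is, the number of closed paths of length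
  \<open>k\<close>. Every closed path passes through \<open>J\<^sub>1\<close> or \<open>J\<^sub>n\<^sub>+\<^sub>1\<close>, where \<open>f\<^sub>n\<close> expands by at least 2, and \<open>f\<^sub>n\<close>
  contracts nowhere; hence a closed path is followed by exactly one fixed point of \<open>f\<^sub>n\<^sup>k\<close>. The
  integers form one periodic orbit on the common boundaries of the intervals; each of them is
  assigned to the one side that its orbit follows consistently, which makes the coding bijective.

  Part (b) is Moebius inversion. For part (c), a positive eigenvector for the root \<open>\<lambda>\<^sub>n\<close> bounds the
  trace from above by a multiple of \<open>\<lambda>\<^sub>n\<^sup>k\<close>, and from below because every state reaches the state
  \<open>n + 1\<close>, which carries a loop, in a bounded number of steps. Points of non-minimal period \<open>m\<close>
  contribute only \<open>O(m \<lambda>\<^sub>n\<^sup>m\<^sup>/\<^sup>2)\<close>.\<close>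

section \<open>The transition graph\<close>

text \<open>An edge records that the image of J_i under f_n covers J_j. Only J_1, stretched by n,
  and J_(n+1), stretched by 2, cover more than one interval.\<close>

definition edge :: "nat \<Rightarrow> nat \<Rightarrow> nat \<Rightarrow> bool" where
  "edge n i j \<longleftrightarrow> (i = 1 \<and> n + 1 \<le> j \<and> j \<le> 2 * n) \<or> (2 \<le> i \<and> i \<le> n \<and> j = 2 * n + 2 - i)
     \<or> (i = n + 1 \<and> (j = n \<or> j = n + 1)) \<or> (n + 2 \<le> i \<and> i \<le> 2 * n \<and> j = 2 * n + 1 - i)"

text \<open>Here \<open>k\<close> counts edges, so a closed path repeats its start as its last
  entry.\<close>

definition paths :: "nat \<Rightarrow> nat \<Rightarrow> nat \<Rightarrow> nat \<Rightarrow> nat list set" where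
  "paths n k i j =
     {w. length w = Suc k \<and> w ! 0 = i \<and> w ! k = j \<and> (\<forall>t<k. edge n (w ! t) (w ! Suc t))}"

context
  fixes n :: nat
  assumes n: "n > 1"
begin

lemma edge_range:
  assumes "edge n i j"
  shows "1 \<le> i" "i \<le> 2 * n" "1 \<le> j" "j \<le> 2 * n"
  using assms n unfolding edge_def by linarith+

lemma finite_edge_pred: "finite {l. edge n l j}"
  by (rule finite_subset[of _ "{..2 * n}"]) (auto dest: edge_range)

text \<open>Predecessors are listed because path counts and \<open>bcoef\<close> both extend at the
  last index while \<open>i\<close> stays fixed.\<close>

lemma edge_pred:
  shows "1 \<le> j \<Longrightarrow> j \<le> n \<Longrightarrow> {l. edge n l j} = {2 * n + 1 - j}"
    and "{l. edge n l (n + 1)} = {1, n + 1}"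
    and "n + 2 \<le> j \<Longrightarrow> j \<le> 2 * n \<Longrightarrow> {l. edge n l j} = {1, 2 * n + 2 - j}"
proof -
  show "{l. edge n l j} = {2 * n + 1 - j}" if "1 \<le> j" "j \<le> n"
  proof -
    have "l = 2 * n + 1 - j" if "edge n l j" for l
      using that \<open>1 \<le> j\<close> \<open>j \<le> n\<close> unfolding edge_def by (elim disjE conjE) linarith+
    moreover have "edge n (2 * n + 1 - j) j"
      using that by (cases "j = n") (auto simp: edge_def)
    ultimately show ?thesis by blast
  qed
  show "{l. edge n l (n + 1)} = {1, n + 1}"
  proof -
    have "l = 1 \<or> l = n + 1" if "edge n l (n + 1)" for l
      using that unfolding edge_def by (elim disjE conjE) linarith+
    moreover have "edge n 1 (n + 1)" "edge n (n + 1) (n + 1)"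
      using n by (simp_all add: edge_def)
    ultimately show ?thesis by blast
  qed
  show "{l. edge n l j} = {1, 2 * n + 2 - j}" if "n + 2 \<le> j" "j \<le> 2 * n"
  proof -
    have "l = 1 \<or> l = 2 * n + 2 - j" if "edge n l j" for l
      using that \<open>n + 2 \<le> j\<close> \<open>j \<le> 2 * n\<close> unfolding edge_def by (elim disjE conjE) linarith+
    moreover have "edge n 1 j" "edge n (2 * n + 2 - j) j"
      using that by (auto simp: edge_def)
    ultimately show ?thesis by blast
  qed
qed

text \<open>Off the states 1 and \<open>n + 1\<close> successors are unique, and two steps lead from
  \<open>l\<close> to \<open>l - 1\<close> when \<open>2 \<le> l \<le> n\<close>. The value is the
  number of these forced steps to state 1; at \<open>n + 1\<close> it is the length of the way
  through \<open>n\<close>.\<close>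

definition steps_to_1 :: "nat \<Rightarrow> nat" where
  "steps_to_1 l = (if l \<le> n then 2 * (l - 1) else 2 * (2 * n - l) + 1)"

lemma steps_to_1_edge:
  assumes "edge n l j" "l \<noteq> 1" "l \<noteq> n + 1"
  shows "steps_to_1 l = Suc (steps_to_1 j)"
  using assms n unfolding edge_def steps_to_1_def by (elim disjE conjE) auto

text \<open>A path avoiding both states would lower \<open>steps_to_1\<close> by one forever. The
  visits are later the source of expansion.\<close>

lemma infinite_path_visits:
  assumes "\<And>t. edge n (w t) (w (Suc t))"
  shows "\<exists>t. w t = 1 \<or> w t = n + 1"
proof (rule ccontr)
  assume *: "\<not> ?thesis"
  have "steps_to_1 (w t) + t = steps_to_1 (w 0)" for t
  proof (induction t)
    case (Suc t)
    have "steps_to_1 (w t) = Suc (steps_to_1 (w (Suc t)))"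
      using * by (intro steps_to_1_edge assms) auto
    then show ?case using Suc by simp
  qed simp
  from this[of "Suc (steps_to_1 (w 0))"] show False by simp
qed

section \<open>Counting paths by their last edge\<close>

lemma paths_0: "paths n 0 i j = (if i = j then {[i]} else {})"
  by (auto simp: paths_def length_Suc_conv)

lemma paths_Suc:
  "paths n (Suc k) i j = (\<Union>l\<in>{l. edge n l j}. (\<lambda>w. w @ [j]) ` paths n k i l)"
proof (intro equalityI subsetI)
  fix w assume w: "w \<in> paths n (Suc k) i j"
  then have len: "length w = Suc (Suc k)" and ends: "w ! 0 = i" "w ! Suc k = j"
    and e: "\<And>t. t < Suc k \<Longrightarrow> edge n (w ! t) (w ! Suc t)"
    by (auto simp: paths_def)
  have "butlast w \<in> paths n k i (w ! k)"
    unfolding paths_def mem_Collect_eq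
  proof (intro conjI allI impI)
    show "edge n (butlast w ! t) (butlast w ! Suc t)" if "t < k" for t
      using e[of t] that len by (simp add: nth_butlast)
  qed (use len ends in \<open>auto simp: nth_butlast\<close>)
  moreover have "last w = j"
    using len ends by (subst last_conv_nth) auto
  then have "w = butlast w @ [j]"
    using len by (metis append_butlast_last_id list.size(3) nat.distinct(1))
  moreover have "edge n (w ! k) j" using e[of k] ends by simp
  ultimately show "w \<in> (\<Union>l\<in>{l. edge n l j}. (\<lambda>w. w @ [j]) ` paths n k i l)" by blast
next
  fix w assume "w \<in> (\<Union>l\<in>{l. edge n l j}. (\<lambda>w. w @ [j]) ` paths n k i l)"
  then show "w \<in> paths n (Suc k) i j"
    by (auto simp: paths_def nth_append less_Suc_eq)
qed

lemma finite_paths: "finite (paths n k i j)"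
  by (induction k arbitrary: j) (auto simp: paths_0 paths_Suc finite_edge_pred)

lemma card_paths_Suc:
  "card (paths n (Suc k) i j) = (\<Sum>l | edge n l j. card (paths n k i l))"
proof -
  have "card (paths n (Suc k) i j) = (\<Sum>l | edge n l j. card ((\<lambda>w. w @ [j]) ` paths n k i l))"
    unfolding paths_Suc
    by (rule card_UN_disjoint) (auto simp: finite_edge_pred finite_paths, auto simp: paths_def)
  also have "\<dots> = (\<Sum>l | edge n l j. card (paths n k i l))"
    by (intro sum.cong refl card_image) (auto simp: inj_on_def)
  finally show ?thesis .
qed

lemma card_paths_Suc_cases:
  shows "1 \<le> j \<Longrightarrow> j \<le> n \<Longrightarrow> card (paths n (Suc k) i j) = card (paths n k i (2 * n + 1 - j))"
    and "card (paths n (Suc k) i (n + 1)) = card (paths n k i 1) + card (paths n k i (n + 1))"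
    and "n + 2 \<le> j \<Longrightarrow> j \<le> 2 * n \<Longrightarrow>
      card (paths n (Suc k) i j) = card (paths n k i 1) + card (paths n k i (2 * n + 2 - j))"
proof -
  show "card (paths n (Suc k) i j) = card (paths n k i (2 * n + 1 - j))" if "1 \<le> j" "j \<le> n"
    unfolding card_paths_Suc edge_pred(1)[OF that] by simp
  show "card (paths n (Suc k) i (n + 1)) = card (paths n k i 1) + card (paths n k i (n + 1))"
    unfolding card_paths_Suc edge_pred(2) using n by simp
  show "card (paths n (Suc k) i j) = card (paths n k i 1) + card (paths n k i (2 * n + 2 - j))"
    if "n + 2 \<le> j" "j \<le> 2 * n"
  proof -
    have "1 \<noteq> 2 * n + 2 - j" using that by linarith
    then show ?thesis unfolding card_paths_Suc edge_pred(3)[OF that] by simp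
  qed
qed

text \<open>In \<open>bcoef\<close> the index \<open>n\<close> stands for the interval \<open>[n, n + 2]\<close>, the index \<open>n + 1\<close> for
  \<open>[n + 1, 2n + 1]\<close>, and any other index \<open>j\<close> for \<open>[j, j + 1]\<close>.\<close>

lemma card_paths_eq_bcoef:
  assumes "1 \<le> j" "j \<le> 2 * n"
  shows "card (paths n (Suc k) i j) = bcoef (Suc k) i j n
     + (if j = n + 1 then bcoef (Suc k) i n n else 0)
     + (if n + 2 \<le> j then bcoef (Suc k) i (n + 1) n else 0)"
  using assms
proof (induction k arbitrary: j)
  case 0
  have *: "card (paths n 0 i l) = (if i = l then 1 else 0)" for l by (simp add: paths_0)
  consider "j \<le> n" | "j = n + 1" | "n + 2 \<le> j" by linarith
  then show ?case
  proof cases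
    case 1
    then have "inQ n i j \<longleftrightarrow> i = 2 * n + 1 - j" using 0 n unfolding inQ_def by linarith
    then show ?thesis using 1 0 by (simp add: card_paths_Suc_cases *)
  next
    case 2
    have "inQ n i (n + 1) \<longleftrightarrow> i = 1" "inQ n i n \<longleftrightarrow> i = n + 1"
      using n unfolding inQ_def by linarith+
    then show ?thesis using 2 n card_paths_Suc_cases(2)[of 0 i] by (simp add: *)
  next
    case 3
    then have "inQ n i j \<longleftrightarrow> i = 2 * n + 2 - j" "inQ n i (n + 1) \<longleftrightarrow> i = 1"
      "1 \<noteq> 2 * n + 2 - j"
      using 0 n unfolding inQ_def by linarith+
    then show ?thesis using 3 0 by (simp add: card_paths_Suc_cases *)
  qed
next
  case (Suc k)
  have one: "card (paths n (Suc k) i 1) = bcoef (Suc k) i 1 n"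
    using Suc.IH[of 1] n by simp
  have mid: "card (paths n (Suc k) i (n + 1)) = bcoef (Suc k) i (n + 1) n + bcoef (Suc k) i n n"
    using Suc.IH[of "n + 1"] n by simp
  have b: "bcoef (Suc (Suc k)) i n n = bcoef (Suc k) i n n + bcoef (Suc k) i (n + 1) n"
    "bcoef (Suc (Suc k)) i (n + 1) n = bcoef (Suc k) i 1 n"
    using n by auto
  consider "j \<le> n - 1" | "j = n" | "j = n + 1" | "n + 2 \<le> j" by linarith
  then show ?case
  proof cases
    case 1
    then have "card (paths n (Suc (Suc k)) i j) = card (paths n (Suc k) i (2 * n + 1 - j))"
      using Suc.prems by (intro card_paths_Suc_cases) auto
    also have "\<dots> = bcoef (Suc k) i (2 * n + 1 - j) n + bcoef (Suc k) i (n + 1) n"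
      using 1 Suc.prems Suc.IH[of "2 * n + 1 - j"] n by simp
    finally show ?thesis using 1 Suc.prems by auto
  next
    case 2
    then show ?thesis using mid b(1) n card_paths_Suc_cases(1)[of n "Suc k" i] by simp
  next
    case 3
    then show ?thesis unfolding 3 card_paths_Suc_cases(2)[of "Suc k"] one mid b by simp
  next
    case 4
    \<comment> \<open>The predecessor \<open>2 * n + 2 - j\<close> is at most \<open>n\<close>, so
      its count is a plain coefficient; the paths through state 1 become the new coefficient at
      \<open>n + 1\<close>.\<close>
    have "card (paths n (Suc k) i (2 * n + 2 - j)) = bcoef (Suc k) i (2 * n + 2 - j) n"
      using 4 Suc.prems Suc.IH[of "2 * n + 2 - j"] by auto
    moreover have "bcoef (Suc (Suc k)) i j n = bcoef (Suc k) i (2 * n + 2 - j) n"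
      using 4 Suc.prems by auto
    ultimately show ?thesis
      using 4 unfolding card_paths_Suc_cases(3)[OF 4 Suc.prems(2)] one b by simp
  qed
qed

text \<open>On the diagonal, the two corrections in \<open>card_paths_eq_bcoef\<close> are exactly
  the two extra terms of \<open>ccoef\<close>, which is therefore the trace.\<close>

lemma sum_closed_paths_eq_ccoef:
  assumes "k \<ge> 1"
  shows "(\<Sum>i = 1..2 * n. card (paths n k i i)) = ccoef k n"
proof -
  obtain k' where k: "k = Suc k'" using assms by (cases k) auto
  have "(\<Sum>i = 1..2 * n. card (paths n k i i)) = (\<Sum>i = 1..2 * n. bcoef k i i n)
     + (\<Sum>i = 1..2 * n. if i = n + 1 then bcoef k i n n else 0)
     + (\<Sum>i = 1..2 * n. if n + 2 \<le> i then bcoef k i (n + 1) n else 0)"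
    unfolding k sum.distrib[symmetric] by (intro sum.cong refl card_paths_eq_bcoef) auto
  also have "(\<Sum>i = 1..2 * n. if i = n + 1 then bcoef k i n n else 0) = bcoef k (n + 1) n n"
    using n by simp
  also have "(\<Sum>i = 1..2 * n. if n + 2 \<le> i then bcoef k i (n + 1) n else 0)
      = (\<Sum>i = n + 2..2 * n. bcoef k i (n + 1) n)"
    by (rule sum.mono_neutral_cong_right) auto
  finally show ?thesis by (simp add: ccoef_def)
qed

end

section \<open>Periodic points as closed paths\<close>

text \<open>The half-open cells cut \<open>[1, 2n + 1]\<close> at the integers. Every integer goes to the side
  that its own (periodic) orbit follows, so that periodic points correspond to closed paths.\<close>

definition cell :: "nat \<Rightarrow> nat \<Rightarrow> real set" where
  "cell n l = (if l \<le> n then {real l..<real l + 1}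
     else if l = n + 1 then {real l..real l + 1} else {real l<..real l + 1})"

definition addr :: "nat \<Rightarrow> real \<Rightarrow> nat" where
  "addr n x = (if x < real n + 1 then nat \<lfloor>x\<rfloor> else if x \<le> real n + 2 then n + 1 else nat (\<lceil>x\<rceil> - 1))"

lemma cell_subset: "cell n l \<subseteq> {real l..real l + 1}"
  by (auto simp: cell_def)

lemma mem_cell_if_not_Ints:
  assumes "x \<in> {real l..real l + 1}" "x \<notin> \<int>"
  shows "x \<in> cell n l"
proof -
  have "x \<noteq> real l" "x \<noteq> real l + 1"
    using assms(2) Ints_of_nat[of l] Ints_of_nat[of "Suc l"] by (auto simp: algebra_simps)
  then show ?thesis using assms(1) by (auto simp: cell_def)
qed

lemma Ints_eq_of_nat:
  fixes x :: real
  assumes "x \<in> \<int>"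
  shows "real m \<le> x \<Longrightarrow> x < real m + 1 \<Longrightarrow> x = real m"
    and "real m < x \<Longrightarrow> x \<le> real m + 1 \<Longrightarrow> x = real m + 1"
proof -
  obtain z where z: "x = of_int z" using assms by (auto elim: Ints_cases)
  show "x = real m" if "real m \<le> x" "x < real m + 1"
  proof -
    have "z = int m" using that z by linarith
    then show ?thesis using z by simp
  qed
  show "x = real m + 1" if "real m < x" "x \<le> real m + 1"
  proof -
    have "z = int m + 1" using that z by linarith
    then show ?thesis using z by simp
  qed
qed

context
  fixes n :: nat
  assumes n: "n > 1"
begin

text \<open>Neighbouring formulas agree at the shared endpoint, so each holds on its whole closed
  interval although \<open>fmap\<close> tests its conditions in order.\<close>

lemma fmap_cases:
  shows "1 \<le> x \<Longrightarrow> x \<le> 2 \<Longrightarrow> fmap n x = real n + 1 + (x - 1) * real n"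
    and "2 \<le> x \<Longrightarrow> x \<le> real n + 1 \<Longrightarrow> fmap n x = 2 * real n + 3 - x"
    and "real n + 1 \<le> x \<Longrightarrow> x \<le> real n + 2 \<Longrightarrow> fmap n x = 3 * real n + 4 - 2 * x"
    and "real n + 2 \<le> x \<Longrightarrow> x \<le> 2 * real n + 1 \<Longrightarrow> fmap n x = 2 * real n + 2 - x"
proof -
  have r: "real n > 1" using n by simp
  have a: "affine_interp 1 2 (real n + 1) (2 * real n + 1) x = real n + 1 + (x - 1) * real n" for x
    by (simp add: affine_interp_def)
  have b: "affine_interp 2 (real n + 1) (2 * real n + 1) (real n + 2) x = 2 * real n + 3 - x" for x
    using r by (simp add: affine_interp_def field_simps)
  have c: "affine_interp (real n + 1) (real n + 2) (real n + 2) (real n) x = 3 * real n + 4 - 2 * x" for x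
    by (simp add: affine_interp_def)
  have d: "affine_interp (real n + 2) (2 * real n + 1) (real n) 1 x = 2 * real n + 2 - x" for x
    using r by (simp add: affine_interp_def field_simps)
  show "fmap n x = real n + 1 + (x - 1) * real n" if "1 \<le> x" "x \<le> 2"
    using that unfolding fmap_def a by simp
  show "fmap n x = 2 * real n + 3 - x" if "2 \<le> x" "x \<le> real n + 1"
    using that unfolding fmap_def a b by auto
  show "fmap n x = 3 * real n + 4 - 2 * x" if "real n + 1 \<le> x" "x \<le> real n + 2"
    using that r unfolding fmap_def a b c by auto
  show "fmap n x = 2 * real n + 2 - x" if "real n + 2 \<le> x" "x \<le> 2 * real n + 1"
    using that r unfolding fmap_def a b c d by auto
qed

lemma fmap_on_interval:
  shows "x \<in> {1..2} \<Longrightarrow> fmap n x = real n + 1 + (x - 1) * real n"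
    and "2 \<le> l \<Longrightarrow> l \<le> n \<Longrightarrow> x \<in> {real l..real l + 1} \<Longrightarrow> fmap n x = 2 * real n + 3 - x"
    and "x \<in> {real (n + 1)..real (n + 1) + 1} \<Longrightarrow> fmap n x = 3 * real n + 4 - 2 * x"
    and "n + 2 \<le> l \<Longrightarrow> l \<le> 2 * n \<Longrightarrow> x \<in> {real l..real l + 1} \<Longrightarrow> fmap n x = 2 * real n + 2 - x"
  by (auto intro!: fmap_cases)

lemma state_cases [consumes 2, case_names first low mid high]:
  assumes "1 \<le> l" "l \<le> 2 * n"
  obtains "l = 1" | "2 \<le> l" "l \<le> n" | "l = n + 1" | "n + 2 \<le> l" "l \<le> 2 * n"
  using assms by linarith

lemma addr_eq:
  assumes "x \<in> cell n l"
  shows "addr n x = l"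
proof -
  consider "l \<le> n" | "l = n + 1" | "n + 2 \<le> l" by linarith
  then show ?thesis
  proof cases
    case 1
    then have "real l \<le> x" "x < real l + 1" "real l \<le> real n" using assms by (auto simp: cell_def)
    moreover from this have "\<lfloor>x\<rfloor> = int l" by (simp add: floor_eq_iff)
    ultimately show ?thesis by (simp add: addr_def)
  next
    case 2
    then show ?thesis using assms by (auto simp: cell_def addr_def)
  next
    case 3
    then have "real l < x" "x \<le> real l + 1" "real n + 2 \<le> real l" using assms by (auto simp: cell_def)
    moreover from this have "\<lceil>x\<rceil> = int l + 1" by (simp add: ceiling_eq_iff)
    ultimately show ?thesis by (simp add: addr_def)
  qed
qed

lemma addr_cell:
  assumes "1 \<le> x" "x \<le> 2 * real n + 1"
  shows "x \<in> cell n (addr n x)" "1 \<le> addr n x" "addr n x \<le> 2 * n"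
proof -
  have "\<exists>l. x \<in> cell n l \<and> 1 \<le> l \<and> l \<le> 2 * n"
  proof -
    consider "x < real n + 1" | "real n + 1 \<le> x" "x \<le> real n + 2" | "real n + 2 < x" by linarith
    then show ?thesis
    proof cases
      case 1
      obtain l where l: "\<lfloor>x\<rfloor> = int l" using assms by (metis floor_le_iff int_ops(2) le_floor_iff
            nonneg_int_cases of_int_1 zero_le_floor dual_order.trans zero_le_one)
      then have "real l \<le> x" "x < real l + 1" by linarith+
      then have "l \<le> n" "1 \<le> l" using 1 assms by linarith+
      then show ?thesis using \<open>real l \<le> x\<close> \<open>x < real l + 1\<close> by (intro exI[of _ l]) (auto simp: cell_def)
    next
      case 2
      then show ?thesis using n by (intro exI[of _ "n + 1"]) (auto simp: cell_def)
    next
      case 3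
      define l where "l = nat (\<lceil>x\<rceil> - 1)"
      have "\<lceil>x\<rceil> \<ge> 1" using assms by linarith
      then have "\<lceil>x\<rceil> = int l + 1" by (simp add: l_def)
      then have "real l < x" "x \<le> real l + 1" by linarith+
      then have "n + 2 \<le> l" "l \<le> 2 * n" using 3 assms by linarith+
      then show ?thesis using \<open>real l < x\<close> \<open>x \<le> real l + 1\<close> by (intro exI[of _ l]) (auto simp: cell_def)
    qed
  qed
  then obtain l where "x \<in> cell n l" "1 \<le> l" "l \<le> 2 * n" by blast
  then show "x \<in> cell n (addr n x)" "1 \<le> addr n x" "addr n x \<le> 2 * n"
    using addr_eq by auto
qed

lemma fmap_first_bounds:
  assumes "1 \<le> x" "x \<le> 2"
  shows "0 \<le> (x - 1) * real n" "(x - 1) * real n \<le> real n"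
    and "x < 2 \<Longrightarrow> (x - 1) * real n < real n"
  using assms n mult_right_mono[of "x - 1" 1 "real n"] mult_strict_right_mono[of "x - 1" 1 "real n"]
  by auto

text \<open>The branches of slope -1 reverse orientation and exchange cells closed on the left with
  cells closed on the right, and the doubly closed cell \<open>n + 1\<close> maps into the cells
  \<open>n\<close> and \<open>n + 1\<close>. Hence itineraries of all points, integers included, are
  paths.\<close>

lemma edge_addr_fmap:
  assumes "x \<in> cell n l" "1 \<le> l" "l \<le> 2 * n"
  shows "edge n l (addr n (fmap n x))"
  using assms(2,3)
proof (cases rule: state_cases)
  case first
  then have x: "1 \<le> x" "x < 2" using assms(1) n by (auto simp: cell_def)
  note b = fmap_first_bounds[of x]
  have f: "fmap n x = real n + 1 + (x - 1) * real n" using x by (intro fmap_cases) auto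
  then have "1 \<le> fmap n x" "fmap n x \<le> 2 * real n + 1" using x b by auto
  note a = addr_cell[OF this]
  have "fmap n x \<le> real (addr n (fmap n x)) + 1"
    using a(1) cell_subset[of n "addr n (fmap n x)"] by auto
  moreover have "fmap n x < real (addr n (fmap n x)) + 1" if "addr n (fmap n x) \<le> n"
    using a(1) that by (auto simp: cell_def)
  ultimately have "\<not> addr n (fmap n x) \<le> n" using f b x by fastforce
  then show ?thesis using first a by (simp add: edge_def)
next
  case low
  then have x: "real l \<le> x" "x < real l + 1" using assms(1) by (auto simp: cell_def)
  then have "fmap n x = 2 * real n + 3 - x" using fmap_on_interval(2)[of l x] low by auto
  then have "fmap n x \<in> cell n (2 * n + 2 - l)" using x low by (auto simp: cell_def of_nat_diff)
  then show ?thesis using low by (simp add: addr_eq edge_def)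
next
  case mid
  then have x: "real n + 1 \<le> x" "x \<le> real n + 2" using assms(1) by (auto simp: cell_def)
  then have f: "fmap n x = 3 * real n + 4 - 2 * x" by (intro fmap_cases)
  have "fmap n x \<in> cell n n \<or> fmap n x \<in> cell n (n + 1)" using x f by (auto simp: cell_def)
  then show ?thesis using mid by (auto simp: edge_def dest!: addr_eq)
next
  case high
  then have x: "real l < x" "x \<le> real l + 1" using assms(1) by (auto simp: cell_def)
  then have "fmap n x = 2 * real n + 2 - x" using fmap_on_interval(4)[of l x] high by auto
  then have "fmap n x \<in> cell n (2 * n + 1 - l)" using x high by (auto simp: cell_def of_nat_diff)
  then show ?thesis using high by (simp add: addr_eq edge_def)
qed

lemma fmap_range:
  assumes "1 \<le> x" "x \<le> 2 * real n + 1"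
  shows "1 \<le> fmap n x" "fmap n x \<le> 2 * real n + 1"
proof -
  have "1 \<le> fmap n x \<and> fmap n x \<le> 2 * real n + 1"
  proof -
    consider "x \<le> 2" | "2 \<le> x" "x \<le> real n + 1" | "real n + 1 \<le> x" "x \<le> real n + 2"
      | "real n + 2 \<le> x" by linarith
    then show ?thesis
      using assms fmap_cases[of x] fmap_first_bounds[of x] n by cases auto
  qed
  then show "1 \<le> fmap n x" "fmap n x \<le> 2 * real n + 1" by auto
qed

lemma funpow_fmap_range:
  assumes "1 \<le> x" "x \<le> 2 * real n + 1"
  shows "1 \<le> (fmap n ^^ t) x \<and> (fmap n ^^ t) x \<le> 2 * real n + 1"
  using assms by (induction t) (auto intro: fmap_range)

lemma fmap_Ints:
  assumes "1 \<le> x" "x \<le> 2 * real n + 1" "x \<in> \<int>"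
  shows "fmap n x \<in> \<int>"
proof -
  consider "x \<le> 2" | "2 \<le> x" "x \<le> real n + 1" | "real n + 1 \<le> x" "x \<le> real n + 2"
    | "real n + 2 \<le> x" by linarith
  then show ?thesis
    using assms by cases (auto simp: fmap_cases)
qed

text \<open>The edge and the closed interval together leave a single possible \<open>j\<close>, and
  the cell of that \<open>j\<close> contains the image. So an integer on its proper side stays on it
  along the path.\<close>

lemma cell_edge_Ints:
  assumes "x \<in> cell n l" "x \<in> \<int>" "edge n l j" "fmap n x \<in> {real j..real j + 1}"
  shows "fmap n x \<in> cell n j"
proof -
  have l: "1 \<le> l" "l \<le> 2 * n" using edge_range[OF n assms(3)] by auto
  note int = Ints_eq_of_nat[OF assms(2)]
  from l show ?thesis
  proof (cases rule: state_cases)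
    case first
    then have "1 \<le> x" "x < 2" using assms(1) n by (auto simp: cell_def)
    then have "x = 1" using int(1)[of 1] by simp
    then have "fmap n x = real n + 1" using fmap_cases(1)[of x] by simp
    moreover have "j \<ge> n + 1" using assms(3) first n by (simp add: edge_def)
    ultimately show ?thesis using assms(4) by (auto simp: cell_def)
  next
    case low
    then have "real l \<le> x" "x < real l + 1" using assms(1) by (auto simp: cell_def)
    then have "x = real l" by (rule int)
    moreover from this have "fmap n x = 2 * real n + 3 - x" using fmap_on_interval(2)[of l x] low by auto
    moreover have "j = 2 * n + 2 - l" using assms(3) low by (simp add: edge_def)
    ultimately show ?thesis using low by (auto simp: cell_def of_nat_diff)
  next
    case mid
    then have "real n + 1 \<le> x" "x \<le> real n + 2" using assms(1) by (auto simp: cell_def)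
    then have "x = real n + 1 \<or> x = real n + 2"
      using int(2)[of "n + 1"] by fastforce
    then have "fmap n x = real n + 2 \<or> fmap n x = real n" using fmap_cases(3)[of x] by auto
    moreover have "j = n \<or> j = n + 1" using assms(3) mid n by (auto simp: edge_def)
    ultimately show ?thesis using assms(4) by (auto simp: cell_def)
  next
    case high
    then have "real l < x" "x \<le> real l + 1" using assms(1) by (auto simp: cell_def)
    then have "x = real l + 1" by (rule int)
    moreover from this have "fmap n x = 2 * real n + 2 - x" using fmap_on_interval(4)[of l x] high by auto
    moreover have "j = 2 * n + 1 - l" using assms(3) high by (simp add: edge_def)
    ultimately show ?thesis using high by (auto simp: cell_def of_nat_diff)
  qed
qed

section \<open>Expansion and inverse branches\<close>

lemma fmap_expanding:
  assumes "1 \<le> l" "l \<le> 2 * n" "x \<in> {real l..real l + 1}" "y \<in> {real l..real l + 1}"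
  shows "\<bar>x - y\<bar> \<le> \<bar>fmap n x - fmap n y\<bar>"
    and "l = 1 \<or> l = n + 1 \<Longrightarrow> 2 * \<bar>x - y\<bar> \<le> \<bar>fmap n x - fmap n y\<bar>"
proof -
  have *: "\<bar>x - y\<bar> \<le> \<bar>fmap n x - fmap n y\<bar> \<and>
    (l = 1 \<or> l = n + 1 \<longrightarrow> 2 * \<bar>x - y\<bar> \<le> \<bar>fmap n x - fmap n y\<bar>)"
    using assms(1,2)
  proof (cases rule: state_cases)
    case first
    then have "fmap n x - fmap n y = (x - y) * real n"
      using assms fmap_on_interval(1) by (simp add: algebra_simps)
    then have "\<bar>fmap n x - fmap n y\<bar> = \<bar>x - y\<bar> * real n" by (simp add: abs_mult)
    moreover have "\<bar>x - y\<bar> * 2 \<le> \<bar>x - y\<bar> * real n" using n by (intro mult_left_mono) auto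
    moreover have "\<bar>x - y\<bar> \<le> \<bar>x - y\<bar> * 2" by simp
    ultimately show ?thesis by linarith
  next
    case low
    then show ?thesis using assms fmap_on_interval(2)[of l] by auto
  next
    case mid
    then have "fmap n x = 3 * real n + 4 - 2 * x" "fmap n y = 3 * real n + 4 - 2 * y"
      using assms fmap_on_interval(3) by auto
    then have "fmap n x - fmap n y = 2 * (y - x)" by simp
    then have "\<bar>fmap n x - fmap n y\<bar> = \<bar>2\<bar> * \<bar>y - x\<bar>" by (simp only: abs_mult)
    then show ?thesis by (simp add: abs_minus_commute)
  next
    case high
    then show ?thesis using assms fmap_on_interval(4)[of l] by auto
  qed
  then show "\<bar>x - y\<bar> \<le> \<bar>fmap n x - fmap n y\<bar>"
    and "l = 1 \<or> l = n + 1 \<Longrightarrow> 2 * \<bar>x - y\<bar> \<le> \<bar>fmap n x - fmap n y\<bar>" by auto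
qed

text \<open>The affine branch on J_l is inverted on all of J_j. Closed intervals are used here
  because Brouwer's theorem will need compactness.\<close>

lemma inverse_branch:
  assumes "edge n l j"
  obtains g where "continuous_on {real j..real j + 1} g"
    "\<And>y. y \<in> {real j..real j + 1} \<Longrightarrow> g y \<in> {real l..real l + 1} \<and> fmap n (g y) = y"
proof -
  have l: "1 \<le> l" "l \<le> 2 * n" using edge_range[OF n assms] by auto
  from l show ?thesis
  proof (cases rule: state_cases)
    case first
    then have j: "n + 1 \<le> j" "j \<le> 2 * n" using assms n by (auto simp: edge_def)
    show ?thesis
    proof (rule that[of "\<lambda>y. 1 + (y - real n - 1) / real n"])
      fix y assume y: "y \<in> {real j..real j + 1}"
      then have "0 \<le> y - real n - 1" "y - real n - 1 \<le> real n" using j by auto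
      then have "1 + (y - real n - 1) / real n \<in> {1..2}" using n by (auto simp: field_simps)
      moreover from this have "fmap n (1 + (y - real n - 1) / real n) = y"
        using n by (subst fmap_on_interval(1)) (auto simp: field_simps)
      ultimately show "1 + (y - real n - 1) / real n \<in> {real l..real l + 1} \<and>
          fmap n (1 + (y - real n - 1) / real n) = y"
        using first by simp
    qed (use n in \<open>auto intro!: continuous_intros\<close>)
  next
    case low
    then have j: "j = 2 * n + 2 - l" using assms by (simp add: edge_def)
    show ?thesis
    proof (rule that[of "\<lambda>y. 2 * real n + 3 - y"])
      fix y assume y: "y \<in> {real j..real j + 1}"
      then have "2 * real n + 3 - y \<in> {real l..real l + 1}" using j low by (auto simp: of_nat_diff)
      then show "2 * real n + 3 - y \<in> {real l..real l + 1} \<and> fmap n (2 * real n + 3 - y) = y"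
        using fmap_on_interval(2)[of l "2 * real n + 3 - y"] low by auto
    qed (auto intro!: continuous_intros)
  next
    case mid
    then have j: "j = n \<or> j = n + 1" using assms n by (auto simp: edge_def)
    show ?thesis
    proof (rule that[of "\<lambda>y. (3 * real n + 4 - y) / 2"])
      fix y assume y: "y \<in> {real j..real j + 1}"
      then have "(3 * real n + 4 - y) / 2 \<in> {real (n + 1)..real (n + 1) + 1}" using j by auto
      then show "(3 * real n + 4 - y) / 2 \<in> {real l..real l + 1} \<and>
          fmap n ((3 * real n + 4 - y) / 2) = y"
        using fmap_on_interval(3)[of "(3 * real n + 4 - y) / 2"] mid by (auto simp: field_simps)
    qed (auto intro!: continuous_intros)
  next
    case high
    then have j: "j = 2 * n + 1 - l" using assms by (simp add: edge_def)
    show ?thesis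
    proof (rule that[of "\<lambda>y. 2 * real n + 2 - y"])
      fix y assume y: "y \<in> {real j..real j + 1}"
      then have "2 * real n + 2 - y \<in> {real l..real l + 1}" using j high by (auto simp: of_nat_diff)
      then show "2 * real n + 2 - y \<in> {real l..real l + 1} \<and> fmap n (2 * real n + 2 - y) = y"
        using fmap_on_interval(4)[of l "2 * real n + 2 - y"] high by auto
    qed (auto intro!: continuous_intros)
  qed
qed

text \<open>The one-step inverse branches are composed. Paths grow at the end, so the branch of the
  new last edge is applied first.\<close>

lemma path_inverse_branch:
  assumes "w \<in> paths n k i j"
  obtains g where "continuous_on {real j..real j + 1} g"
    "\<And>y. y \<in> {real j..real j + 1} \<Longrightarrow> (fmap n ^^ k) (g y) = y \<and>
       (\<forall>t\<le>k. (fmap n ^^ t) (g y) \<in> {real (w ! t)..real (w ! t) + 1})"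
  using assms
proof (induction k arbitrary: j w thesis)
  case 0
  then have "w = [j]" by (auto simp: paths_0[OF n] split: if_splits)
  then show ?case by (intro "0.prems"(1)[of "\<lambda>y. y"]) auto
next
  case (Suc k)
  from Suc.prems(2) obtain l v where lv: "edge n l j" "v \<in> paths n k i l" "w = v @ [j]"
    by (auto simp: paths_Suc[OF n])
  obtain g where g: "continuous_on {real l..real l + 1} g"
    "\<And>y. y \<in> {real l..real l + 1} \<Longrightarrow> (fmap n ^^ k) (g y) = y \<and>
       (\<forall>t\<le>k. (fmap n ^^ t) (g y) \<in> {real (v ! t)..real (v ! t) + 1})"
    using Suc.IH lv(2) by blast
  obtain h where h: "continuous_on {real j..real j + 1} h"
    "\<And>y. y \<in> {real j..real j + 1} \<Longrightarrow> h y \<in> {real l..real l + 1} \<and> fmap n (h y) = y"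
    using inverse_branch[OF lv(1)] by blast
  have len: "length v = Suc k" using lv(2) by (simp add: paths_def)
  show ?case
  proof (rule Suc.prems(1)[of "g \<circ> h"])
    show "continuous_on {real j..real j + 1} (g \<circ> h)"
      using h by (intro continuous_on_compose continuous_on_subset[OF g(1)]) auto
    fix y assume y: "y \<in> {real j..real j + 1}"
    have *: "(fmap n ^^ Suc k) ((g \<circ> h) y) = y" using g(2) h(2) y by simp
    show "(fmap n ^^ Suc k) ((g \<circ> h) y) = y \<and>
       (\<forall>t\<le>Suc k. (fmap n ^^ t) ((g \<circ> h) y) \<in> {real (w ! t)..real (w ! t) + 1})"
    proof (intro conjI allI impI)
      fix t assume "t \<le> Suc k"
      then consider "t \<le> k" | "t = Suc k" by linarith
      then show "(fmap n ^^ t) ((g \<circ> h) y) \<in> {real (w ! t)..real (w ! t) + 1}"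
      proof cases
        case 1
        then show ?thesis using g(2) h(2) y len lv(3) by (auto simp: nth_append)
      next
        case 2
        then show ?thesis using * y len lv(3) by (simp add: nth_append)
      qed
    qed (fact *)
  qed
qed

text \<open>A periodic integer that lies in \<open>[w\<^sub>t, w\<^sub>t + 1]\<close> but on the wrong side of the cell boundary stays on
  the wrong side only until the path reaches state 1, and never returns to it.\<close>

lemma periodic_itinerary_in_cells:
  assumes k: "k > 0" and x: "1 \<le> x" "x \<le> 2 * real n + 1" "(fmap n ^^ k) x = x"
    and w: "\<And>t. edge n (w t) (w (Suc t))" "\<And>t. w (t + k) = w t"
    and in_w: "\<And>t. (fmap n ^^ t) x \<in> {real (w t)..real (w t) + 1}"
  shows "(fmap n ^^ t) x \<in> cell n (w t)"
proof -
  have per: "(fmap n ^^ (t + k * s)) x = (fmap n ^^ t) x" for t s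
    using funpow_mod_eq[OF x(3)] by (metis mod_mult_self2)
  have wper: "w (t + k * s) = w t" for t s
  proof (induction s)
    case (Suc s)
    then show ?case using w(2)[of "t + k * s"] by (simp add: algebra_simps)
  qed simp
  show ?thesis
  proof (cases "\<exists>s. (fmap n ^^ s) x \<in> \<int>")
    case False
    then show ?thesis using mem_cell_if_not_Ints in_w by blast
  next
    case True
    then obtain s where s: "(fmap n ^^ s) x \<in> \<int>" by blast
    have "(fmap n ^^ (s + t)) x \<in> \<int>" for t
      using s funpow_fmap_range[OF x(1,2)] by (induction t) (auto intro: fmap_Ints)
    \<comment> \<open>The orbit is integral from time \<open>s\<close> on, and periodicity carries
      this to all times.\<close>
    then have ints: "(fmap n ^^ t) x \<in> \<int>" for t
      using per[of t s] k by (metis add.commute le_Suc_ex mult_le_mono1 nat_mult_1 add.left_commute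
          One_nat_def Suc_leI)
    have "\<exists>s. (fmap n ^^ s) x \<in> cell n (w s)"
    proof -
      obtain t where "w t = 1 \<or> w t = n + 1" using infinite_path_visits[of n w] n w(1) by blast
      then show ?thesis
      proof
        assume "w t = n + 1"
        then show ?thesis using in_w[of t] by (auto simp: cell_def intro!: exI[of _ t])
      next
        assume w1: "w t = 1"
        \<comment> \<open>The only point of J_1 outside its cell is 2. Its image
          \<open>2n + 1\<close> lies in no interval but J_(2n), whose cell contains it.\<close>
        show ?thesis
        proof (cases "(fmap n ^^ t) x = 2")
          case True
          then have f: "(fmap n ^^ Suc t) x = 2 * real n + 1" using fmap_cases(1)[of 2] by simp
          have "w (Suc t) \<le> 2 * n" using edge_range[OF n w(1)] by blast
          moreover have "2 * real n + 1 \<le> real (w (Suc t)) + 1" using in_w[of "Suc t"] f by auto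
          ultimately have "w (Suc t) = 2 * n" by linarith
          then have "(fmap n ^^ Suc t) x \<in> cell n (w (Suc t))" using f n by (auto simp: cell_def)
          then show ?thesis by blast
        next
          case False
          then show ?thesis using in_w[of t] w1 n by (auto simp: cell_def intro!: exI[of _ t])
        qed
      qed
    qed
    then obtain s where s: "(fmap n ^^ s) x \<in> cell n (w s)" by blast
    have step: "(fmap n ^^ (s + t)) x \<in> cell n (w (s + t))" for t
    proof (induction t)
      case (Suc t)
      then show ?case
        using cell_edge_Ints[OF Suc ints w(1)[of "s + t"]] in_w[of "Suc (s + t)"] by simp
    qed (use s in simp)
    \<comment> \<open>Membership propagates only forward from \<open>s\<close>, so \<open>t\<close>
      is replaced by a later time congruent to it modulo \<open>k\<close>.\<close>
    have "s \<le> t + k * s" using k by (simp add: trans_le_add2)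
    then obtain r where "t + k * s = s + r" using le_Suc_ex by blast
    then show ?thesis using step[of r] per[of t s] wper[of t s] by simp
  qed
qed

text \<open>For a closed path the inverse branch maps J_i into itself, and a fixed point of it is a
  fixed point of the \<open>k\<close>-th iterate. The path, extended periodically by
  \<open>t mod k\<close>, then gives the exact cells and not just the closed intervals.\<close>

lemma closed_path_fixpoint:
  assumes k: "k > 0" and w: "w \<in> paths n k i i"
  obtains x where "1 \<le> x" "x \<le> 2 * real n + 1" "(fmap n ^^ k) x = x"
    "\<And>t. t \<le> k \<Longrightarrow> addr n ((fmap n ^^ t) x) = w ! t"
proof -
  have w0: "w ! 0 = i" "w ! k = i" and e: "\<And>t. t < k \<Longrightarrow> edge n (w ! t) (w ! Suc t)"
    using w by (auto simp: paths_def)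
  have i: "1 \<le> i" "i \<le> 2 * n" using edge_range[OF n e[OF k]] w0 by auto
  obtain g where g: "continuous_on {real i..real i + 1} g"
    "\<And>y. y \<in> {real i..real i + 1} \<Longrightarrow> (fmap n ^^ k) (g y) = y \<and>
       (\<forall>t\<le>k. (fmap n ^^ t) (g y) \<in> {real (w ! t)..real (w ! t) + 1})"
    using path_inverse_branch[OF w] by blast
  have "g \<in> {real i..real i + 1} \<rightarrow> {real i..real i + 1}"
  proof
    fix y assume "y \<in> {real i..real i + 1}"
    then have "(fmap n ^^ 0) (g y) \<in> {real (w ! 0)..real (w ! 0) + 1}" using g(2) by blast
    then show "g y \<in> {real i..real i + 1}" using w0 by simp
  qed
  then obtain x where x: "x \<in> {real i..real i + 1}" "g x = x"
    using brouwer[of "{real i..real i + 1}" g] g(1) by auto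
  then have fx: "(fmap n ^^ k) x = x"
    and inw: "\<And>t. t \<le> k \<Longrightarrow> (fmap n ^^ t) x \<in> {real (w ! t)..real (w ! t) + 1}"
    using g(2)[of x] by auto
  have rng: "1 \<le> x" "x \<le> 2 * real n + 1" using x(1) i by auto
  let ?w = "\<lambda>t. w ! (t mod k)"
  have "(fmap n ^^ t) x \<in> cell n (?w t)" for t
  proof (rule periodic_itinerary_in_cells[OF k rng fx])
    show "edge n (?w t) (?w (Suc t))" for t
      using e[of "t mod k"] k w0 by (auto simp: mod_Suc)
    show "(fmap n ^^ t) x \<in> {real (?w t)..real (?w t) + 1}" for t
      using inw[of "t mod k"] funpow_mod_eq[OF fx, of t] k by simp
  qed simp
  then have a: "addr n ((fmap n ^^ t) x) = ?w t" for t by (rule addr_eq)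
  show ?thesis
  proof (rule that[OF rng fx])
    show "addr n ((fmap n ^^ t) x) = w ! t" if "t \<le> k" for t
      using a[of t] that w0 by (cases "t = k") auto
  qed
qed

text \<open>The distance \<open>D\<close> between the two orbits never decreases and at least
  doubles at a visit to 1 or \<open>n + 1\<close>. Being periodic, it must vanish.\<close>

lemma itinerary_inj:
  assumes k: "k > 0" and x: "1 \<le> x" "x \<le> 2 * real n + 1" "(fmap n ^^ k) x = x"
    and y: "1 \<le> y" "y \<le> 2 * real n + 1" "(fmap n ^^ k) y = y"
    and eq: "\<And>t. t \<le> k \<Longrightarrow> addr n ((fmap n ^^ t) x) = addr n ((fmap n ^^ t) y)"
  shows "x = y"
proof -
  define w where "w = (\<lambda>t. addr n ((fmap n ^^ t) x))"
  define D where "D = (\<lambda>t. \<bar>(fmap n ^^ t) x - (fmap n ^^ t) y\<bar>)"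
  note rx = funpow_fmap_range[OF x(1,2)] and ry = funpow_fmap_range[OF y(1,2)]
  have wy: "w t = addr n ((fmap n ^^ t) y)" for t
    using eq[of "t mod k"] k funpow_mod_eq[OF x(3), of t] funpow_mod_eq[OF y(3), of t]
    by (simp add: w_def less_imp_le)
  have cx: "(fmap n ^^ t) x \<in> cell n (w t)" and w: "1 \<le> w t" "w t \<le> 2 * n" for t
    using addr_cell[of "(fmap n ^^ t) x"] rx[of t] by (auto simp: w_def)
  have cy: "(fmap n ^^ t) y \<in> cell n (w t)" for t
    using addr_cell[of "(fmap n ^^ t) y"] ry[of t] by (auto simp: wy)
  have "edge n (w t) (w (Suc t))" for t
    using edge_addr_fmap[OF cx w, of t] by (simp add: w_def)
  then obtain t where t: "w t = 1 \<or> w t = n + 1" using infinite_path_visits[OF n] by blast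
  have D: "D t \<le> D (Suc t)" and D2: "w t = 1 \<or> w t = n + 1 \<Longrightarrow> 2 * D t \<le> D (Suc t)" for t
    using fmap_expanding[OF w[of t] subsetD[OF cell_subset cx] subsetD[OF cell_subset cy]]
    by (simp_all add: D_def)
  have mono: "a \<le> b \<Longrightarrow> D a \<le> D b" for a b
    using D by (rule lift_Suc_mono_le)
  \<comment> \<open>The time \<open>k * Suc t\<close> is a multiple of the period that is not before
    \<open>Suc t\<close>, the moment after a doubling.\<close>
  have "D (k * Suc t) = D 0"
    using funpow_mod_eq[OF x(3), of "k * Suc t"] funpow_mod_eq[OF y(3), of "k * Suc t"]
    by (simp add: D_def del: mult_Suc_right)
  moreover have "D (Suc t) \<le> D (k * Suc t)" using k by (intro mono) (cases k; simp)
  moreover have "2 * D 0 \<le> 2 * D t" using mono[of 0 t] by simp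
  ultimately have "D 0 \<le> 0" using D2[OF t] by linarith
  then show ?thesis by (simp add: D_def)
qed

text \<open>Taking itineraries is a bijection onto closed paths: injective by expansion, surjective
  by the inverse branches. Finiteness is recorded for the later partition by minimal period.\<close>

lemma card_fixpoints_fmap:
  assumes k: "k > 0"
  defines "F \<equiv> {x. 1 \<le> x \<and> x \<le> 2 * real n + 1 \<and> (fmap n ^^ k) x = x}"
  shows "finite F" "card F = ccoef k n"
proof -
  define P where "P = (\<Union>i\<in>{1..2 * n}. paths n k i i)"
  define it where "it = (\<lambda>x. map (\<lambda>t. addr n ((fmap n ^^ t) x)) [0..<Suc k])"
  have nth: "it x ! t = addr n ((fmap n ^^ t) x)" if "t \<le> k" for x t
    using that by (simp add: it_def del: upt_Suc)
  have "bij_betw it F P"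
  proof (rule bij_betwI')
    fix x y assume xy: "x \<in> F" "y \<in> F"
    have "x = y" if "it x = it y"
    proof (rule itinerary_inj[OF k])
      show "addr n ((fmap n ^^ t) x) = addr n ((fmap n ^^ t) y)" if "t \<le> k" for t
        using nth[OF that] \<open>it x = it y\<close> by metis
    qed (use xy in \<open>auto simp: F_def\<close>)
    then show "it x = it y \<longleftrightarrow> x = y" by blast
  next
    fix x assume "x \<in> F"
    then have x: "1 \<le> x" "x \<le> 2 * real n + 1" "(fmap n ^^ k) x = x" by (auto simp: F_def)
    have a: "(fmap n ^^ t) x \<in> cell n (addr n ((fmap n ^^ t) x))"
      "1 \<le> addr n ((fmap n ^^ t) x)" "addr n ((fmap n ^^ t) x) \<le> 2 * n" for t
      using addr_cell[of "(fmap n ^^ t) x"] funpow_fmap_range[OF x(1,2), of t] by auto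
    have "it x \<in> paths n k (addr n x) (addr n x)"
      unfolding paths_def mem_Collect_eq
    proof (intro conjI allI impI)
      show "edge n (it x ! t) (it x ! Suc t)" if "t < k" for t
        using edge_addr_fmap[OF a, of t] that by (simp add: nth)
    qed (use x in \<open>simp_all add: nth\<close>, simp add: it_def)
    then show "it x \<in> P" using a[of 0] by (auto simp: P_def)
  next
    fix v assume "v \<in> P"
    then obtain i where v: "v \<in> paths n k i i" by (auto simp: P_def)
    obtain x where x: "1 \<le> x" "x \<le> 2 * real n + 1" "(fmap n ^^ k) x = x"
      "\<And>t. t \<le> k \<Longrightarrow> addr n ((fmap n ^^ t) x) = v ! t"
      using closed_path_fixpoint[OF k v] by blast
    have "length v = Suc k" using v by (simp add: paths_def)
    then have "v = it x"
      by (intro nth_equalityI) (simp add: it_def, simp add: nth x(4))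
    then show "\<exists>x\<in>F. v = it x" using x by (auto simp: F_def)
  qed
  moreover have "finite P" by (simp add: P_def finite_paths[OF n])
  moreover have "card P = (\<Sum>i = 1..2 * n. card (paths n k i i))"
    unfolding P_def
    by (rule card_UN_disjoint) (auto simp: finite_paths[OF n], auto simp: paths_def)
  ultimately show "finite F" "card F = ccoef k n"
    using sum_closed_paths_eq_ccoef[OF n, of k] k bij_betw_finite bij_betw_same_card by fastforce+
qed

end

section \<open>Moebius inversion and periodic orbits\<close>

text \<open>Squarefree divisors correspond to sets of prime factors through
  \<open>A \<mapsto> \<Prod>A\<close>; the facts \<open>sqf\<close> and \<open>surj\<close> are the
  two directions. The alternating sum over subsets is a product of factors \<open>(-1) + 1\<close>,
  which is empty only for \<open>m = 1\<close>.\<close>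

lemma sum_moebius_divisors:
  assumes "m > 0"
  shows "(\<Sum>d | d dvd m. moebius d) = (if m = 1 then 1 else 0)"
proof -
  let ?P = "prime_factors m"
  have sqf: "squarefree (\<Prod>A) \<and> prime_factors (\<Prod>A) = A \<and> \<Prod>A dvd m" if "A \<subseteq> ?P" for A
  proof -
    have fin: "finite A" using that finite_subset by blast
    have pr: "prime p" if "p \<in> A" for p using that \<open>A \<subseteq> ?P\<close> by auto
    have mult: "multiplicity p (\<Prod>A) = (if p \<in> A then 1 else 0)" if "prime p" for p
      using multiplicity_prod_prime_powers[of A p "\<lambda>_. 1"] fin pr that by simp
    have nz: "\<Prod>A \<noteq> 0" using fin pr by (metis not_prime_0 prod_zero_iff)
    have "squarefree (\<Prod>A)"
      using nz by (subst squarefree_factorial_semiring'') (auto simp: mult)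
    moreover have "prime_factors (\<Prod>A) = A"
      using nz pr mult by (auto simp: prime_factors_multiplicity split: if_splits)
    moreover have "\<Prod>A dvd m"
    proof (rule multiplicity_le_imp_dvd)
      fix p :: nat assume "prime p"
      then show "multiplicity p (\<Prod>A) \<le> multiplicity p m"
        using that by (auto simp: mult prime_factors_multiplicity Suc_le_eq)
    qed (fact nz)
    ultimately show ?thesis by blast
  qed
  have surj: "d = \<Prod>(prime_factors d)" if "squarefree d" "d dvd m" for d
  proof -
    have "d \<noteq> 0" using that assms by auto
    have "(\<Prod>p\<in>prime_factors d. p ^ multiplicity p d) = \<Prod>(prime_factors d)"
      using that \<open>d \<noteq> 0\<close>
      by (intro prod.cong refl) (auto simp: squarefree_factorial_semiring' )
    then show ?thesis using prime_factorization_nat[of d] \<open>d \<noteq> 0\<close> by simp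
  qed
  have "(\<Sum>d | d dvd m. moebius d) = (\<Sum>d | d dvd m \<and> squarefree d. moebius d)"
    using assms by (intro sum.mono_neutral_right) (auto simp: moebius_def)
  also have "\<dots> = (\<Sum>A\<in>Pow ?P. (-1) ^ card A)"
    by (rule sum.reindex_bij_witness[of _ "\<lambda>A. \<Prod>A" prime_factors])
       (use sqf surj assms in \<open>auto simp: moebius_def dest: dvd_prime_factors[rotated]\<close>)
  also have "\<dots> = (\<Prod>p\<in>?P. (-1) + 1)"
    by (subst prod_add) (auto)
  also have "\<dots> = (if m = 1 then 1 else 0)"
    using assms by (auto simp: prime_factorization_empty_iff power_0_left)
  finally show ?thesis .
qed

lemma PhiM_inversion:
  assumes "\<And>k. k > 0 \<Longrightarrow> \<phi> k = (\<Sum>d | d dvd k. a d)" and "m > 0"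
  shows "PhiM m \<phi> = a m"
proof -
  have fin: "finite {d. d dvd k}" if "k > 0" for k :: nat using that by simp
  have "PhiM m \<phi> = (\<Sum>d | d dvd m. \<Sum>e | e dvd d. moebius (m div d) * a e)"
    unfolding PhiM_def using assms
    by (intro sum.cong refl) (auto simp: sum_distrib_left dest: dvd_pos_nat)
  also have "\<dots> = (\<Sum>(d, e)\<in>(SIGMA d:{d. d dvd m}. {e. e dvd d}). moebius (m div d) * a e)"
    using assms(2) by (subst sum.Sigma) (auto intro: fin dest: dvd_pos_nat)
  \<comment> \<open>Substituting \<open>c = m div d\<close> turns the chain \<open>e dvd d\<close>,
    \<open>d dvd m\<close> into \<open>e dvd m\<close>, \<open>c dvd m div e\<close>, which isolates
    a full Moebius sum for each \<open>e\<close>.\<close>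
  also have "\<dots> = (\<Sum>(e, c)\<in>(SIGMA e:{e. e dvd m}. {c. c dvd m div e}). moebius c * a e)"
    by (rule sum.reindex_bij_witness[of _ "\<lambda>(e, c). (m div c, e)" "\<lambda>(d, e). (e, m div d)"])
       (use assms(2) in \<open>auto elim!: dvdE simp: div_mult2_eq\<close>)
  also have "\<dots> = (\<Sum>e | e dvd m. (\<Sum>c | c dvd m div e. moebius c) * a e)"
    using assms(2) by (subst sum.Sigma[symmetric])
      (auto intro!: fin sum.cong simp: sum_distrib_right dvd_imp_le dest: dvd_pos_nat
        simp: dvd_div_eq_0_iff)
  also have "\<dots> = (\<Sum>e | e dvd m. if e = m then a e else 0)"
  proof (intro sum.cong refl)
    fix e assume "e \<in> {e. e dvd m}"
    then have "m div e > 0" "m div e = 1 \<longleftrightarrow> e = m"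
      using assms(2) by (auto elim!: dvdE)
    then show "(\<Sum>c | c dvd m div e. moebius c) * a e = (if e = m then a e else 0)"
      by (simp add: sum_moebius_divisors)
  qed
  also have "\<dots> = a m" using assms(2) by simp
  finally show ?thesis .
qed

section \<open>Orbits and minimal periods\<close>

text \<open>With \<open>d\<close> the least period, the first \<open>d\<close> iterates are distinct
  and exhaust the orbit. This links minimality expressed by orbit size to divisibility of
  periods.\<close>

lemma card_orbit_periodic:
  assumes "k > 0" "(f ^^ k) x = x"
  shows "card (orbit f x) > 0" "(f ^^ card (orbit f x)) x = x" "card (orbit f x) dvd k"
proof -
  define d where "d = (LEAST d. d > 0 \<and> (f ^^ d) x = x)"
  have d: "d > 0" "(f ^^ d) x = x"
    using LeastI[of "\<lambda>d. d > 0 \<and> (f ^^ d) x = x" k] assms by (auto simp: d_def)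
  have min: "r = 0" if "r < d" "(f ^^ r) x = x" for r
    using not_less_Least[of r "\<lambda>d. d > 0 \<and> (f ^^ d) x = x"] that by (auto simp: d_def)
  have orb: "orbit f x = (\<lambda>j. (f ^^ j) x) ` {..<d}"
  proof -
    have "(f ^^ j) x \<in> (\<lambda>j. (f ^^ j) x) ` {..<d}" for j
      using funpow_mod_eq[OF d(2), of j] d(1) by (metis imageI lessThan_iff mod_less_divisor)
    then show ?thesis by (auto simp: orbit_def)
  qed
  have "inj_on (\<lambda>j. (f ^^ j) x) {..<d}"
  proof (rule linorder_inj_onI)
    fix a b assume ab: "a < b" "a \<in> {..<d}" "b \<in> {..<d}"
    show "(f ^^ a) x \<noteq> (f ^^ b) x"
    proof
      assume "(f ^^ a) x = (f ^^ b) x"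
      \<comment> \<open>Another \<open>d - b\<close> iterations take time \<open>b\<close> to
        \<open>d\<close>, so \<open>d - b + a\<close> would be a positive period below
        \<open>d\<close>.\<close>
      then have "(f ^^ (d - b + a)) x = (f ^^ (d - b + b)) x"
        by (simp add: funpow_add)
      then have "d - b + a = 0" using ab d by (intro min) auto
      then show False using ab by auto
    qed
  qed auto
  then have c: "card (orbit f x) = d" by (simp add: orb card_image)
  show "card (orbit f x) > 0" "(f ^^ card (orbit f x)) x = x" using c d by auto
  have "(f ^^ (k mod d)) x = x" using funpow_mod_eq[OF d(2), of k] assms(2) by simp
  then have "k mod d = 0" using d(1) by (intro min) auto
  then show "card (orbit f x) dvd k" using c by auto
qed

lemma orbit_eq:
  assumes "k > 0" "(f ^^ k) x = x" "y \<in> orbit f x"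
  shows "orbit f y = orbit f x" "(f ^^ k) y = y"
proof -
  obtain a where y: "y = (f ^^ a) x" using assms(3) by (auto simp: orbit_def)
  show "(f ^^ k) y = y"
    unfolding y using assms(2) by (metis add.commute comp_apply funpow_add)
  have "(f ^^ j) x \<in> orbit f y" for j
  proof -
    \<comment> \<open>Since \<open>k > 0\<close>, adding \<open>k * a\<close> moves the time past
      \<open>a\<close>, where the iterate is reached from \<open>y\<close>.\<close>
    have "(f ^^ (j + k * a)) x = (f ^^ j) x"
      using funpow_mod_eq[OF assms(2)] by (metis mod_mult_self2)
    moreover have "j + k * a = (j + k * a - a) + a" using assms(1) by (simp add: trans_le_add2)
    ultimately have "(f ^^ j) x = (f ^^ (j + k * a - a)) y"
      unfolding y by (metis comp_apply funpow_add)
    then show ?thesis by (auto simp: orbit_def)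
  qed
  moreover have "(f ^^ j) y \<in> orbit f x" for j
    unfolding y orbit_def by (metis (mono_tags, lifting) comp_apply funpow_add mem_Collect_eq)
  ultimately show "orbit f y = orbit f x" by (auto simp: orbit_def)
qed

definition fixpts :: "(real \<Rightarrow> real) \<Rightarrow> real set \<Rightarrow> nat \<Rightarrow> real set" where
  "fixpts f S k = {x\<in>S. (f ^^ k) x = x}"

definition min_period_pts :: "(real \<Rightarrow> real) \<Rightarrow> real set \<Rightarrow> nat \<Rightarrow> real set" where
  "min_period_pts f S m = {x\<in>S. (f ^^ m) x = x \<and> card (orbit f x) = m}"

lemma card_fixpts_sum:
  assumes "k > 0" "finite (fixpts f S k)"
  shows "card (fixpts f S k) = (\<Sum>d | d dvd k. card (min_period_pts f S d))"
proof -
  have iter: "(f ^^ k) x = x" if "d dvd k" "(f ^^ d) x = x" for d x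
    using funpow_mod_eq[OF that(2), of k] that(1) by simp
  have "fixpts f S k = (\<Union>d\<in>{d. d dvd k}. min_period_pts f S d)"
    using card_orbit_periodic[OF assms(1)]
    by (auto simp: fixpts_def min_period_pts_def intro: iter)
  then show ?thesis
    using assms by (subst (asm) (1) \<open>fixpts f S k = _\<close>, simp only:, subst card_UN_disjoint)
      (auto simp: min_period_pts_def)
qed

text \<open>The points of minimal period \<open>m\<close> are a union of orbits of size
  \<open>m\<close>, and two orbits that meet coincide by \<open>orbit_eq\<close>.\<close>

lemma card_orbits:
  assumes "m > 0" "\<And>x. x \<in> S \<Longrightarrow> f x \<in> S" "finite (min_period_pts f S m)"
  shows "m * card (orbit f ` min_period_pts f S m) = card (min_period_pts f S m)"
proof -
  have S: "(f ^^ j) x \<in> S" if "x \<in> S" for j x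
    using that by (induction j) (auto intro: assms)
  have *: "\<Union>(orbit f ` min_period_pts f S m) = min_period_pts f S m"
  proof (intro equalityI subsetI)
    fix y assume "y \<in> \<Union>(orbit f ` min_period_pts f S m)"
    then obtain x where x: "x \<in> min_period_pts f S m" "y \<in> orbit f x" by auto
    then have "y \<in> S" using S by (auto simp: orbit_def min_period_pts_def)
    then show "y \<in> min_period_pts f S m"
      using x orbit_eq[OF assms(1), of f x y] by (auto simp: min_period_pts_def)
  next
    fix x assume "x \<in> min_period_pts f S m"
    moreover have "x \<in> orbit f x" unfolding orbit_def by (auto intro: exI[of _ 0])
    ultimately show "x \<in> \<Union>(orbit f ` min_period_pts f S m)" by blast
  qed
  have "m * card (orbit f ` min_period_pts f S m) = card (\<Union>(orbit f ` min_period_pts f S m))"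
  proof (rule card_partition)
    show "finite (\<Union>(orbit f ` min_period_pts f S m))" using * assms by simp
    show "c1 \<inter> c2 = {}" if "c1 \<in> orbit f ` min_period_pts f S m"
      "c2 \<in> orbit f ` min_period_pts f S m" "c1 \<noteq> c2" for c1 c2
    proof (rule ccontr)
      assume "c1 \<inter> c2 \<noteq> {}"
      then obtain y where "y \<in> c1" "y \<in> c2" by blast
      then have "orbit f y = c1" "orbit f y = c2"
        using that orbit_eq(1)[OF assms(1), of f _ y] by (auto simp: min_period_pts_def)
      then show False using that by simp
    qed
  qed (use assms in \<open>auto simp: min_period_pts_def\<close>)
  then show ?thesis using * by simp
qed

section \<open>Growth of the number of closed paths\<close>

text \<open>The root satisfies \<open>l ^ (2 * n - 1) * (l\<^sup>2 - 2) = 1\<close> with both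
  factors positive, and both grow strictly beyond \<open>l\<close>. Allowing an inequality for
  \<open>x\<close> serves uniqueness as well as the bound on complex zeros.\<close>

lemma trinomial_root_le:
  fixes l x :: real
  assumes n: "n > 1" and l: "l > 0" "l ^ (2 * n + 1) - 2 * l ^ (2 * n - 1) - 1 = 0"
    and x: "x \<ge> 0" "x ^ (2 * n + 1) - 2 * x ^ (2 * n - 1) - 1 \<le> 0"
  shows "x \<le> l"
proof (rule ccontr)
  assume "\<not> x \<le> l"
  then have xl: "l < x" by simp
  have e: "2 * n + 1 = (2 * n - 1) + 2" using n by simp
  have split: "y ^ (2 * n + 1) - 2 * y ^ (2 * n - 1) = y ^ (2 * n - 1) * (y\<^sup>2 - 2)" for y :: real
    unfolding e power_add by (simp add: algebra_simps)
  have l1: "l ^ (2 * n - 1) * (l\<^sup>2 - 2) = 1" using l(2) split[of l] by simp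
  then have "l\<^sup>2 - 2 > 0" using l(1) zero_less_mult_pos[of "l ^ (2 * n - 1)" "l\<^sup>2 - 2"] by simp
  moreover have "l\<^sup>2 < x\<^sup>2" using xl l(1) by (intro power_strict_mono) auto
  moreover have "l ^ (2 * n - 1) < x ^ (2 * n - 1)" using xl l(1) n by (intro power_strict_mono) auto
  ultimately have "l ^ (2 * n - 1) * (l\<^sup>2 - 2) < x ^ (2 * n - 1) * (x\<^sup>2 - 2)"
    using l(1) xl by (intro mult_strict_mono) auto
  then show False using x(2) split[of x] l1 by simp
qed

text \<open>Intermediate value theorem on \<open>{1..2}\<close>. The bound \<open>l > 1\<close>
  makes \<open>eigvec\<close> positive.\<close>

lemma trinomial_root_exists:
  assumes n: "n > 1"
  obtains l :: real where "l > 1" "l ^ (2 * n + 1) - 2 * l ^ (2 * n - 1) - 1 = 0"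
proof -
  let ?p = "\<lambda>x::real. x ^ (2 * n + 1) - 2 * x ^ (2 * n - 1) - 1"
  have "2 * n + 1 = (2 * n - 1) + 2" using n by simp
  then have "(2::real) ^ (2 * n + 1) = 4 * 2 ^ (2 * n - 1)" by (simp only: power_add) simp
  moreover have "(2::real) ^ (2 * n - 1) \<ge> 1" by (rule one_le_power) simp
  ultimately have "?p 2 \<ge> 0" by linarith
  moreover have "?p 1 \<le> 0" by simp
  moreover have "continuous_on {1..2} ?p" by (intro continuous_intros)
  ultimately obtain l where l: "1 \<le> l" "l \<le> 2" "?p l = 0"
    using IVT'[of ?p 1 0 2] by auto
  moreover have "l \<noteq> 1" using l(3) by auto
  ultimately show ?thesis using that[of l] by simp
qed

text \<open>The eigenvector equations of the transition matrix, solved starting from the value 1 at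
  \<open>n + 1\<close>. The equation at state 1 is left over; multiplied by \<open>L + 1\<close>, it becomes the trinomial
  equation.\<close>

definition eigvec :: "nat \<Rightarrow> real \<Rightarrow> nat \<Rightarrow> real" where
  "eigvec n L i = (if i \<le> n then L ^ (2 * (n - i)) * (L - 1) else if i = n + 1 then 1
     else L ^ (2 * (i - n) - 3) * (L - 1))"

context
  fixes n :: nat and L :: real
  assumes n: "n > 1" and L: "L > 1" "L ^ (2 * n + 1) - 2 * L ^ (2 * n - 1) - 1 = 0"
begin

lemma eigvec_pos: "eigvec n L i > 0"
  using L by (simp add: eigvec_def)

text \<open>The factor \<open>L + 1\<close> turns each term after the first into a difference of odd
  powers of \<open>L\<close>, so the sum telescopes.\<close>

lemma sum_eigvec:
  "(L + 1) * (\<Sum>j = n + 1..n + 1 + t. eigvec n L j) = L + 1 + L * (L ^ (2 * t) - 1)"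
proof (induction t)
  case 0
  then show ?case by (simp add: eigvec_def)
next
  case (Suc t)
  have "eigvec n L (n + 1 + Suc t) = L ^ (2 * t + 1) * (L - 1)"
    by (simp add: eigvec_def)
  then have "(L + 1) * (\<Sum>j = n + 1..n + 1 + Suc t. eigvec n L j)
      = L + 1 + L * (L ^ (2 * t) - 1) + (L + 1) * (L ^ (2 * t + 1) * (L - 1))"
    using Suc by (simp add: distrib_left del: mult_Suc_right)
  then show ?case by (simp add: algebra_simps)
qed

lemma eigvec_edges:
  assumes "1 \<le> l" "l \<le> 2 * n"
  shows "(\<Sum>j | j \<in> {1..2 * n} \<and> edge n l j. eigvec n L j) = L * eigvec n L l"
proof -
  consider "l = 1" | "2 \<le> l" "l \<le> n" | "l = n + 1" | "n + 2 \<le> l" using assms by linarith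
  then show ?thesis
  proof cases
    case 1
    then have "{j \<in> {1..2 * n}. edge n l j} = {n + 1..n + 1 + (n - 1)}"
      using n by (auto simp: edge_def)
    then have "(L + 1) * (\<Sum>j | j \<in> {1..2 * n} \<and> edge n l j. eigvec n L j)
        = L + 1 + L * (L ^ (2 * (n - 1)) - 1)"
      by (simp only: sum_eigvec)
    also have "\<dots> = L ^ (2 * n - 1) + 1"
    proof -
      have "2 * n - 1 = Suc (2 * (n - 1))" using n by simp
      then show ?thesis by (simp add: algebra_simps)
    qed
    \<comment> \<open>This is the trinomial equation, rearranged.\<close>
    also have "\<dots> = L ^ (2 * n - 1) * (L\<^sup>2 - 1)"
    proof -
      have e: "2 * n + 1 = (2 * n - 1) + 2" using n by simp
      show ?thesis using L(2) unfolding e power_add by (simp add: algebra_simps)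
    qed
    also have "\<dots> = (L + 1) * (L * eigvec n L l)"
    proof -
      have e: "2 * n - 1 = Suc (2 * (n - 1))" using n by simp
      show ?thesis using 1 n unfolding e by (simp add: eigvec_def algebra_simps power2_eq_square)
    qed
    finally show ?thesis using L(1) by simp
  next
    case 2
    then have "{j \<in> {1..2 * n}. edge n l j} = {2 * n + 2 - l}" by (auto simp: edge_def)
    moreover have "2 * (2 * n + 2 - l - n) - 3 = Suc (2 * (n - l))" "\<not> 2 * n + 2 - l \<le> n"
      "2 * n + 2 - l \<noteq> n + 1"
      using 2 by linarith+
    then have "eigvec n L (2 * n + 2 - l) = L * (L ^ (2 * (n - l)) * (L - 1))"
      by (simp only: eigvec_def if_False power_Suc mult.assoc)
    ultimately show ?thesis using 2 by (simp add: eigvec_def)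
  next
    case 3
    then have "{j \<in> {1..2 * n}. edge n l j} = {n, n + 1}" using n by (auto simp: edge_def)
    then show ?thesis using 3 by (simp add: eigvec_def)
  next
    case 4
    then have "{j \<in> {1..2 * n}. edge n l j} = {2 * n + 1 - l}" using assms n by (auto simp: edge_def)
    moreover have e: "2 * (n - (2 * n + 1 - l)) = Suc (2 * (l - n) - 3)" "2 * n + 1 - l \<le> n"
      using 4 assms by linarith+
    then have "eigvec n L (2 * n + 1 - l) = L * (L ^ (2 * (l - n) - 3) * (L - 1))"
      by (simp only: eigvec_def if_True power_Suc mult.assoc)
    ultimately show ?thesis using 4 by (simp add: eigvec_def)
  qed
qed

lemma sum_paths_eigvec:
  assumes "1 \<le> i" "i \<le> 2 * n"
  shows "(\<Sum>j = 1..2 * n. real (card (paths n k i j)) * eigvec n L j) = L ^ k * eigvec n L i"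
proof (induction k)
  case 0
  have "(\<Sum>j = 1..2 * n. real (card (paths n 0 i j)) * eigvec n L j)
      = (\<Sum>j = 1..2 * n. if i = j then eigvec n L j else 0)"
    by (intro sum.cong refl) (simp add: paths_0[OF n])
  then show ?case using assms by simp
next
  case (Suc k)
  have "(\<Sum>j = 1..2 * n. real (card (paths n (Suc k) i j)) * eigvec n L j)
      = (\<Sum>j = 1..2 * n. \<Sum>l | l \<in> {1..2 * n} \<and> edge n l j. real (card (paths n k i l)) * eigvec n L j)"
  proof (intro sum.cong refl)
    fix j
    have "{l. edge n l j} = {l \<in> {1..2 * n}. edge n l j}" using edge_range[OF n] by auto
    then show "real (card (paths n (Suc k) i j)) * eigvec n L j
        = (\<Sum>l | l \<in> {1..2 * n} \<and> edge n l j. real (card (paths n k i l)) * eigvec n L j)"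
      by (simp add: card_paths_Suc[OF n] sum_distrib_right)
  qed
  also have "\<dots> = (\<Sum>l = 1..2 * n. \<Sum>j | j \<in> {1..2 * n} \<and> edge n l j.
      real (card (paths n k i l)) * eigvec n L j)"
    by (rule sum.swap_restrict) auto
  also have "\<dots> = (\<Sum>l = 1..2 * n. real (card (paths n k i l)) * (L * eigvec n L l))"
    unfolding sum_distrib_left[symmetric]
    by (intro sum.cong refl arg_cong2[of _ _ _ _ "(*)"] eigvec_edges) auto
  also have "\<dots> = L * (\<Sum>l = 1..2 * n. real (card (paths n k i l)) * eigvec n L l)"
    by (simp add: sum_distrib_left algebra_simps)
  finally show ?case using Suc by simp
qed

text \<open>The diagonal entry is one nonnegative summand of \<open>sum_paths_eigvec\<close>;
  cancelling \<open>eigvec n L i\<close> bounds each of the \<open>2 * n\<close> entries by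
  \<open>L ^ k\<close>.\<close>

lemma ccoef_upper:
  assumes "k \<ge> 1"
  shows "real (ccoef k n) \<le> 2 * real n * L ^ k"
proof -
  have "real (card (paths n k i i)) \<le> L ^ k" if i: "i \<in> {1..2 * n}" for i
  proof -
    have "real (card (paths n k i i)) * eigvec n L i
        \<le> (\<Sum>j = 1..2 * n. real (card (paths n k i j)) * eigvec n L j)"
      using i eigvec_pos
      by (intro member_le_sum mult_nonneg_nonneg) (auto intro: less_imp_le)
    then show ?thesis using sum_paths_eigvec[of i k] i eigvec_pos[of i] by simp
  qed
  then have "(\<Sum>i = 1..2 * n. real (card (paths n k i i))) \<le> (\<Sum>i = 1..2 * n. L ^ k)"
    by (intro sum_mono)
  then show ?thesis
    using sum_closed_paths_eq_ccoef[OF n assms] by (simp flip: of_nat_sum)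
qed

lemma card_paths_le_edge:
  assumes "edge n l j"
  shows "card (paths n k i l) \<le> card (paths n (Suc k) i j)"
  unfolding card_paths_Suc[OF n]
  by (rule member_le_sum[of l _ "\<lambda>l. card (paths n k i l)"]) (use assms finite_edge_pred[OF n] in auto)

lemma card_paths_le_loop: "card (paths n k i (n + 1)) \<le> card (paths n (k + r) i (n + 1))"
proof (induction r)
  case (Suc r)
  have "edge n (n + 1) (n + 1)" by (simp add: edge_def)
  from card_paths_le_edge[OF this, of "k + r" i] Suc show ?case by simp
qed simp

text \<open>A path ending at \<open>l\<close> is prolonged by the forced steps to state 1 and the
  edge from there to \<open>n + 1\<close>; from \<open>n + 1\<close> itself the loop is used
  throughout.\<close>

lemma card_paths_le_reach:
  assumes "1 \<le> l" "l \<le> 2 * n"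
  shows "card (paths n k i l) \<le> card (paths n (k + Suc (steps_to_1 n l)) i (n + 1))"
  using assms
proof (induction "steps_to_1 n l" arbitrary: l k rule: less_induct)
  case less
  consider "l = 1" | "l = n + 1" | "l \<noteq> 1" "l \<noteq> n + 1" by blast
  then show ?case
  proof cases
    case 1
    then have "edge n l (n + 1)" using n by (simp add: edge_def)
    then have "card (paths n k i l) \<le> card (paths n (Suc k) i (n + 1))" by (rule card_paths_le_edge)
    also have "\<dots> \<le> card (paths n (Suc k + steps_to_1 n l) i (n + 1))" by (rule card_paths_le_loop)
    finally show ?thesis by simp
  next
    case 2
    show ?thesis unfolding 2 by (rule card_paths_le_loop)
  next
    case 3
    then have "\<exists>j. edge n l j" using less.prems unfolding edge_def by (cases "l \<le> n") auto
    then obtain j where j: "edge n l j" by blast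
    have s: "steps_to_1 n l = Suc (steps_to_1 n j)" using steps_to_1_edge[OF n j] 3 by simp
    have "card (paths n k i l) \<le> card (paths n (Suc k) i j)" using j by (rule card_paths_le_edge)
    also have "\<dots> \<le> card (paths n (Suc k + Suc (steps_to_1 n j)) i (n + 1))"
      using s edge_range[OF n j] by (intro less.hyps) auto
    finally show ?thesis using s by simp
  qed
qed

lemma ccoef_lower:
  obtains K where "K > 0" "\<And>k. k \<ge> 2 * n \<Longrightarrow> K * L ^ k \<le> real (ccoef k n)"
proof -
  define V where "V = (\<Sum>j = 1..2 * n. eigvec n L j)"
  have V: "V > 0" unfolding V_def using n eigvec_pos by (intro sum_pos) auto
  have *: "L ^ k \<le> real (ccoef (k + 2 * n) n) * V" for k
  proof -
    let ?N = "card (paths n (k + 2 * n) (n + 1) (n + 1))"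
    have N: "card (paths n k (n + 1) l) \<le> ?N" if l: "l \<in> {1..2 * n}" for l
    proof -
      \<comment> \<open>The maximum \<open>2 * n\<close> occurs at \<open>l = n + 1\<close>. For
        smaller values the remaining \<open>r\<close> steps are spent in the loop, so one length
        serves all \<open>l\<close>.\<close>
      have "Suc (steps_to_1 n l) \<le> 2 * n" using l n unfolding steps_to_1_def[OF n] by auto
      then obtain r where r: "k + 2 * n = k + Suc (steps_to_1 n l) + r"
        by (metis add.assoc le_Suc_ex)
      have "card (paths n k (n + 1) l) \<le> card (paths n (k + Suc (steps_to_1 n l)) (n + 1) (n + 1))"
        using l by (intro card_paths_le_reach) auto
      also have "\<dots> \<le> ?N" unfolding r by (rule card_paths_le_loop)
      finally show ?thesis .
    qed
    have "L ^ k = L ^ k * eigvec n L (n + 1)" by (simp add: eigvec_def)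
    also have "\<dots> = (\<Sum>j = 1..2 * n. real (card (paths n k (n + 1) j)) * eigvec n L j)"
      using n by (intro sum_paths_eigvec[symmetric]) auto
    also have "\<dots> \<le> (\<Sum>j = 1..2 * n. real ?N * eigvec n L j)"
      using N eigvec_pos by (intro sum_mono mult_right_mono) (auto simp: less_imp_le)
    also have "\<dots> = real ?N * V" by (simp add: V_def sum_distrib_left)
    also have "?N \<le> (\<Sum>i = 1..2 * n. card (paths n (k + 2 * n) i i))"
      by (rule member_le_sum[of "n + 1" _ "\<lambda>i. card (paths n (k + 2 * n) i i)"]) (use n in auto)
    then have "real ?N * V \<le> real (ccoef (k + 2 * n) n) * V"
      using V n sum_closed_paths_eq_ccoef[OF n, of "k + 2 * n"] by (intro mult_right_mono) auto
    finally show ?thesis .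
  qed
  show ?thesis
  \<comment> \<open>\<open>V\<close> comes from replacing all path counts by \<open>?N\<close>, and
    \<open>L ^ (2 * n)\<close> undoes the shift of the length by \<open>2 * n\<close>.\<close>
  proof (rule that[of "1 / (V * L ^ (2 * n))"])
    show "1 / (V * L ^ (2 * n)) > 0" using V L by simp
    fix k assume k: "k \<ge> 2 * n"
    have "L ^ k = L ^ (k - 2 * n) * L ^ (2 * n)" using k by (simp flip: power_add)
    moreover have "L ^ (k - 2 * n) \<le> real (ccoef k n) * V" using *[of "k - 2 * n"] k by simp
    ultimately show "1 / (V * L ^ (2 * n)) * L ^ k \<le> real (ccoef k n)"
      using V L by (simp add: divide_simps)
  qed
qed

end

section \<open>From all periodic points to those of minimal period\<close>

text \<open>Proper divisors of \<open>m\<close> are at most \<open>m / 2\<close>, so they contribute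
  at most \<open>m * C * s ^ m\<close> with \<open>s = sqrt L\<close>. Eventually \<open>a m\<close>
  lies between \<open>K / 2 * L ^ m\<close> and \<open>C * L ^ m\<close>, and constants and the
  factor \<open>1 / m\<close> vanish in the limit.\<close>

lemma primitive_count_growth:
  fixes a c :: "nat \<Rightarrow> nat" and L C K :: real
  assumes L: "L > 1" and K: "K > 0"
    and c: "\<And>k. k > 0 \<Longrightarrow> c k = (\<Sum>d | d dvd k. a d)"
    and upper: "\<And>k. k > 0 \<Longrightarrow> real (c k) \<le> C * L ^ k"
    and lower: "\<And>k. k \<ge> k0 \<Longrightarrow> K * L ^ k \<le> real (c k)"
  shows "(\<lambda>m. ln (real (a m) / real m) / real m) \<longlonglongrightarrow> ln L"
proof -
  define s where "s = sqrt L"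
  have s: "s > 1" "s * s = L" using L by (auto simp: s_def)
  have ac: "a k \<le> c k" if "k > 0" for k
    unfolding c[OF that] by (rule member_le_sum[of k _ a]) (use that in auto)
  have C: "C > 0"
  proof -
    let ?k = "Suc k0"
    have "0 < K * L ^ ?k" using K L by simp
    also have "\<dots> \<le> C * L ^ ?k" using lower[of ?k] upper[of ?k] by simp
    finally have "0 < C * L ^ ?k" .
    from zero_less_mult_pos2[OF this] show ?thesis using L by simp
  qed
  have rest: "real (c m) \<le> real (a m) + real m * (C * s ^ m)" if m: "m > 0" for m
  proof -
    let ?D = "{d. d dvd m} - {m}"
    have "c m = a m + (\<Sum>d\<in>?D. a d)"
      using m by (simp add: c sum.remove[of _ m])
    moreover have "real (a d) \<le> C * s ^ m" if d: "d \<in> ?D" for d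
    proof -
      obtain q where q: "m = d * q" using d by auto
      have "d > 0" "q > 1" using d m q by (auto simp: neq0_conv intro: ccontr)
      then have "2 * d \<le> m" using q by simp
      have "real (a d) \<le> C * L ^ d" using ac[of d] upper[of d] \<open>d > 0\<close> by linarith
      also have "L ^ d = s ^ (2 * d)" by (simp add: s(2)[symmetric] power_mult power2_eq_square)
      also have "C * s ^ (2 * d) \<le> C * s ^ m"
        using C s \<open>2 * d \<le> m\<close> by (intro mult_left_mono power_increasing) auto
      finally show ?thesis .
    qed
    then have "(\<Sum>d\<in>?D. real (a d)) \<le> real (card ?D) * (C * s ^ m)"
      by (intro sum_bounded_above)
    moreover have "card ?D \<le> card {1..m}"
      using m by (intro card_mono) (auto dest: dvd_imp_le intro: Suc_leI dvd_pos_nat)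
    then have "real (card ?D) * (C * s ^ m) \<le> real m * (C * s ^ m)"
      using C s by (intro mult_right_mono) auto
    ultimately show ?thesis by simp
  qed
  have "(\<lambda>m. real m / s ^ m) \<longlonglongrightarrow> 0" using lim_n_over_pown[of s] s by simp
  \<comment> \<open>The threshold lets the proper divisors use up at most half of the lower bound
    \<open>K * L ^ m\<close>.\<close>
  then have "\<forall>\<^sub>F m in sequentially. real m / s ^ m < K / (2 * C)"
    using K C by (intro order_tendstoD) auto
  then have low: "\<forall>\<^sub>F m in sequentially. K / 2 * L ^ m \<le> real (a m)"
    using eventually_ge_at_top[of "Suc k0"]
  proof eventually_elim
    case (elim m)
    then have "real m * C \<le> K / 2 * s ^ m" using s C by (simp add: field_simps)
    then have "real m * C * s ^ m \<le> K / 2 * s ^ m * s ^ m" using s by (intro mult_right_mono) auto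
    also have "\<dots> = K / 2 * L ^ m" by (simp add: s(2)[symmetric] power_mult_distrib)
    finally have "real m * (C * s ^ m) \<le> K / 2 * L ^ m" by (simp add: mult.assoc)
    then show ?case using rest[of m] lower[of m] elim by simp
  qed
  have lim: "(\<lambda>m. ln B / real m + ln L - ln (real m) / real m) \<longlonglongrightarrow> ln L" for B
    using tendsto_diff[OF tendsto_add[OF lim_const_over_n[of "ln B"] tendsto_const[of "ln L"]]
        lim_ln_over_n] by simp
  have ln_eq: "ln (B * L ^ m / real m) / real m = ln B / real m + ln L - ln (real m) / real m"
    if "B > 0" "m > 0" for B m
    using that L by (simp add: ln_div ln_mult ln_realpow field_simps)
  show ?thesis
  proof (rule tendsto_sandwich[OF _ _ lim[of "K / 2"] lim[of C]])
    show "\<forall>\<^sub>F m in sequentially. ln (K / 2) / real m + ln L - ln (real m) / real m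
        \<le> ln (real (a m) / real m) / real m"
      using low eventually_gt_at_top[of 0]
    proof eventually_elim
      case (elim m)
      have "0 < K / 2 * L ^ m" using K L by simp
      then have "ln (K / 2 * L ^ m / real m) / real m \<le> ln (real (a m) / real m) / real m"
        using elim by (intro divide_right_mono ln_mono) (auto intro: divide_right_mono)
      then show ?case using ln_eq[of "K / 2" m] K elim by simp
    qed
    show "\<forall>\<^sub>F m in sequentially. ln (real (a m) / real m) / real m
        \<le> ln C / real m + ln L - ln (real m) / real m"
      using low eventually_gt_at_top[of 0]
    proof eventually_elim
      case (elim m)
      have "0 < K / 2 * L ^ m" using K L by simp
      \<comment> \<open>Comparing logarithms needs a positive argument, so the lower bound enters
        the upper estimate too.\<close>
      then have "0 < real (a m)" using elim by linarith
      moreover have "real (a m) \<le> C * L ^ m" using ac[of m] upper[of m] elim by linarith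
      ultimately have "ln (real (a m) / real m) / real m \<le> ln (C * L ^ m / real m) / real m"
        using elim by (intro divide_right_mono ln_mono) (auto intro: divide_right_mono)
      then show ?case using ln_eq[of C m] C elim by simp
    qed
  qed
qed

theorem theorem2:
  fixes n :: nat
  assumes "n > 1"
  shows "(\<forall>k::nat. k \<ge> 1 \<longrightarrow>
            card {x::real. 1 \<le> x \<and> x \<le> 2 * real n + 1 \<and> (fmap n ^^ k) x = x} = ccoef k n)
       \<and> (\<forall>m::nat. m \<ge> 1 \<longrightarrow>
            real (card {orbit (fmap n) x | x. 1 \<le> x \<and> x \<le> 2 * real n + 1
                          \<and> (fmap n ^^ m) x = x \<and> card (orbit (fmap n) x) = m})
            = real_of_int (Phi_n n m) / real m)
       \<and> (\<exists>l::real. l > 0 \<and> l ^ (2 * n + 1) - 2 * l ^ (2 * n - 1) - 1 = 0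
            \<and> (\<forall>y::real. y > 0 \<and> y ^ (2 * n + 1) - 2 * y ^ (2 * n - 1) - 1 = 0 \<longrightarrow> y = l)
            \<and> (\<forall>z::complex. z ^ (2 * n + 1) - 2 * z ^ (2 * n - 1) - 1 = 0 \<longrightarrow> cmod z \<le> l)
            \<and> ((\<lambda>m. ln (real_of_int (Phi_n n m) / real m) / real m) \<longlonglongrightarrow> ln l))"
proof (intro conjI allI impI)
  define S where "S = {x. 1 \<le> x \<and> x \<le> 2 * real n + 1}"
  define a where "a = (\<lambda>m. card (min_period_pts (fmap n) S m))"
  have fixpts: "fixpts (fmap n) S k = {x. 1 \<le> x \<and> x \<le> 2 * real n + 1 \<and> (fmap n ^^ k) x = x}" for k
    by (auto simp: fixpts_def S_def)
  show A: "card {x::real. 1 \<le> x \<and> x \<le> 2 * real n + 1 \<and> (fmap n ^^ k) x = x} = ccoef k n"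
    if "k \<ge> 1" for k
    using card_fixpoints_fmap(2)[OF assms] that by simp
  have fin: "finite (fixpts (fmap n) S k)" if "k > 0" for k
    using card_fixpoints_fmap(1)[OF assms that] by (simp add: fixpts)
  have c: "ccoef k n = (\<Sum>d | d dvd k. a d)" if "k > 0" for k
    using card_fixpts_sum[OF that fin[OF that]] A[of k] that by (simp add: fixpts a_def)
  have Phi: "Phi_n n m = int (a m)" if "m > 0" for m
    unfolding Phi_n_def using that by (intro PhiM_inversion) (simp_all add: c)
  show "real (card {orbit (fmap n) x | x. 1 \<le> x \<and> x \<le> 2 * real n + 1
          \<and> (fmap n ^^ m) x = x \<and> card (orbit (fmap n) x) = m}) = real_of_int (Phi_n n m) / real m"
    if "m \<ge> 1" for m
  proof -
    have "finite (min_period_pts (fmap n) S m)"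
      using fin[of m] that by (auto simp: min_period_pts_def fixpts_def elim!: rev_finite_subset)
    then have "m * card (orbit (fmap n) ` min_period_pts (fmap n) S m) = a m"
      unfolding a_def using that fmap_range[OF assms] by (intro card_orbits) (auto simp: S_def)
    moreover have "orbit (fmap n) ` min_period_pts (fmap n) S m
        = {orbit (fmap n) x | x. 1 \<le> x \<and> x \<le> 2 * real n + 1
          \<and> (fmap n ^^ m) x = x \<and> card (orbit (fmap n) x) = m}"
      by (auto simp: min_period_pts_def S_def)
    ultimately have "real m * real (card {orbit (fmap n) x | x. 1 \<le> x \<and> x \<le> 2 * real n + 1
          \<and> (fmap n ^^ m) x = x \<and> card (orbit (fmap n) x) = m}) = real (a m)"
      by (metis of_nat_mult)
    then show ?thesis using that Phi[of m] by (simp add: field_simps)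
  qed
  obtain l :: real where l: "l > 1" "l ^ (2 * n + 1) - 2 * l ^ (2 * n - 1) - 1 = 0"
    using trinomial_root_exists[OF assms] .
  have l0: "l > 0" using l(1) by simp
  obtain K where K: "K > 0" "\<And>k. k \<ge> 2 * n \<Longrightarrow> K * l ^ k \<le> real (ccoef k n)"
    using ccoef_lower[OF assms l] by blast
  have "(\<lambda>m. ln (real (a m) / real m) / real m) \<longlonglongrightarrow> ln l"
    using ccoef_upper[OF assms l]
    by (intro primitive_count_growth[OF l(1) K(1) c _ K(2), of "2 * real n"]) auto
  moreover have "\<forall>\<^sub>F m in sequentially. ln (real (a m) / real m) / real m
      = ln (real_of_int (Phi_n n m) / real m) / real m"
    using eventually_gt_at_top[of 0] by eventually_elim (simp add: Phi)
  ultimately have "(\<lambda>m. ln (real_of_int (Phi_n n m) / real m) / real m) \<longlonglongrightarrow> ln l"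
    by (rule Lim_transform_eventually)
  moreover have "y = l" if y: "y > 0" "y ^ (2 * n + 1) - 2 * y ^ (2 * n - 1) - 1 = 0" for y :: real
    using trinomial_root_le[OF assms, of l y] trinomial_root_le[OF assms, of y l] l y by simp
  moreover have "cmod z \<le> l" if z: "z ^ (2 * n + 1) - 2 * z ^ (2 * n - 1) - 1 = 0" for z
  proof -
    \<comment> \<open>By the triangle inequality the trinomial is nonpositive at
      \<open>cmod z\<close>, which is all that \<open>trinomial_root_le\<close> asks for.\<close>
    have "z ^ (2 * n + 1) = 2 * z ^ (2 * n - 1) + 1" using z by (simp add: algebra_simps)
    then have "cmod z ^ (2 * n + 1) = cmod (2 * z ^ (2 * n - 1) + 1)" by (metis norm_power)
    also have "\<dots> \<le> 2 * cmod z ^ (2 * n - 1) + 1"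
      by (rule norm_triangle_le) (simp add: norm_mult norm_power)
    finally have "cmod z ^ (2 * n + 1) - 2 * cmod z ^ (2 * n - 1) - 1 \<le> 0" by linarith
    from trinomial_root_le[OF assms l0 l(2) norm_ge_zero this] show ?thesis .
  qed
  ultimately show "\<exists>l::real. l > 0 \<and> l ^ (2 * n + 1) - 2 * l ^ (2 * n - 1) - 1 = 0
      \<and> (\<forall>y::real. y > 0 \<and> y ^ (2 * n + 1) - 2 * y ^ (2 * n - 1) - 1 = 0 \<longrightarrow> y = l)
      \<and> (\<forall>z::complex. z ^ (2 * n + 1) - 2 * z ^ (2 * n - 1) - 1 = 0 \<longrightarrow> cmod z \<le> l)
      \<and> ((\<lambda>m. ln (real_of_int (Phi_n n m) / real m) / real m) \<longlonglongrightarrow> ln l)"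
    using l0 l(2) by blast
qed

end
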